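(* Let $k\ge 1$, let $F_k$ be the free group of rank $k$ with free generators $x_1,\dots,x_k$, and let $\phi\colon F_k\to F_k$ be an injective group endomorphism. Then the mapping torus $$\mathrm{HNN}_\phi(F_k)=\langle x_1,\dots,x_k,t\mid t x_i t^{-1}=\phi(x_i),\ i=1,\dots,k\rangle$$ is a residually finite group.
   Context: A group is residually finite if the intersection of its subgroups of finite index is trivial. *)

theory Defs
  imports "HOL-Algebra.Algebra"
begin

section \<open>Free groups as groups of reduced words\<close>

text \<open>The letter \<open>(s, True)\<close> stands for the generator \<open>s\<close>, the letter \<open>(s, False)\<close> for its formal inverse.\<close>

type_synonym 'a word = "('a \<times> bool) list"

definition inv_letter :: "'a \<times> bool \<Rightarrow> 'a \<times> bool" where
  "inv_letter a = (fst a, \<not> snd a)"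

definition reduced :: "'a word \<Rightarrow> bool" where
  "reduced w \<longleftrightarrow> successively (\<lambda>a b. b \<noteq> inv_letter a) w"

fun cancel_cons :: "'a \<times> bool \<Rightarrow> 'a word \<Rightarrow> 'a word" where
  "cancel_cons a [] = [a]"
| "cancel_cons a (b # w) = (if b = inv_letter a then w else a # b # w)"

definition reduce :: "'a word \<Rightarrow> 'a word" where
  "reduce w = foldr cancel_cons w []"

definition free_group :: "'a set \<Rightarrow> 'a word monoid" where
  "free_group S =
    \<lparr>carrier = {w. reduced w \<and> fst ` set w \<subseteq> S},
     monoid.mult = (\<lambda>u v. reduce (u @ v)),
     one = []\<rparr>"

definition gen :: "'a \<Rightarrow> 'a word" where
  "gen s = [(s, True)]"

section \<open>Group presentations\<close>

definition normal_closure :: "('g, 'b) monoid_scheme \<Rightarrow> 'g set \<Rightarrow> 'g set" where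
  "normal_closure G R =
    generate G {g \<otimes>\<^bsub>G\<^esub> r \<otimes>\<^bsub>G\<^esub> inv\<^bsub>G\<^esub> g | g r. g \<in> carrier G \<and> r \<in> R}"

text \<open>Relators are meant to be elements of \<open>carrier (free_group S)\<close>.\<close>

definition presented_group :: "'a set \<Rightarrow> 'a word set \<Rightarrow> 'a word set monoid" where
  "presented_group S R = free_group S Mod normal_closure (free_group S) R"

section \<open>Mapping tori and residual finiteness\<close>

datatype torus_gen = Base nat | Stable

abbreviation base_gens :: "nat \<Rightarrow> torus_gen set" where
  "base_gens k \<equiv> Base ` {1..k}"

text \<open>The free group on the base generators is literally contained in the free group on the base
  generators and the stable letter, so \<open>\<phi> (gen (Base i))\<close> can be used in the relators as it is.\<close>

definition mapping_torus ::
    "nat \<Rightarrow> (torus_gen word \<Rightarrow> torus_gen word) \<Rightarrow> torus_gen word set monoid" where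
  "mapping_torus k \<phi> =
    (let S = insert Stable (base_gens k); F = free_group S in
     presented_group S
       {gen Stable \<otimes>\<^bsub>F\<^esub> gen (Base i) \<otimes>\<^bsub>F\<^esub> inv\<^bsub>F\<^esub> gen Stable \<otimes>\<^bsub>F\<^esub> inv\<^bsub>F\<^esub> \<phi> (gen (Base i))
        | i. i \<in> {1..k}})"

text \<open>The intersection below is over a nonempty family, since it contains \<open>carrier G\<close>.\<close>

definition residually_finite :: "('g, 'b) monoid_scheme \<Rightarrow> bool" where
  "residually_finite G \<longleftrightarrow>
    group G \<and> \<Inter>{H. subgroup H G \<and> finite (rcosets\<^bsub>G\<^esub> H)} = {\<one>\<^bsub>G\<^esub>}"

section \<open>Basic properties\<close>

lemma inv_letter_inv_letter [simp]: "inv_letter (inv_letter a) = a"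
  by (simp add: inv_letter_def)

lemma fst_inv_letter [simp]: "fst (inv_letter a) = fst a"
  by (simp add: inv_letter_def)

lemma inv_letter_neq [simp]: "inv_letter a \<noteq> a" "a \<noteq> inv_letter a"
  by (auto simp: inv_letter_def prod_eq_iff)

lemma reduced_Nil [simp]: "reduced []"
  by (simp add: reduced_def)

lemma reduced_Cons:
  "reduced (a # w) \<longleftrightarrow> reduced w \<and> (w = [] \<or> hd w \<noteq> inv_letter a)"
  by (cases w) (auto simp: reduced_def)

lemma reduced_cancel_cons: "reduced w \<Longrightarrow> reduced (cancel_cons a w)"
  by (cases w) (auto simp: reduced_Cons)

lemma set_cancel_cons: "set (cancel_cons a w) \<subseteq> insert a (set w)"
  by (cases w) auto

lemma cancel_cons_inv: "reduced w \<Longrightarrow> cancel_cons a (cancel_cons (inv_letter a) w) = w"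
  by (cases w; cases "tl w") (auto simp: reduced_Cons)

lemma reduce_simps [simp]: "reduce [] = []" "reduce (a # w) = cancel_cons a (reduce w)"
  by (simp_all add: reduce_def)

lemma reduced_reduce [simp]: "reduced (reduce w)"
  by (induction w) (auto simp: reduced_cancel_cons)

lemma set_reduce: "set (reduce w) \<subseteq> set w"
  by (induction w) (use set_cancel_cons in fastforce)+

lemma reduce_reduced: "reduced w \<Longrightarrow> reduce w = w"
proof (induction w)
  case (Cons a w)
  then show ?case by (cases w) (auto simp: reduced_Cons)
qed simp

lemma reduce_append_right: "reduce (u @ reduce v) = reduce (u @ v)"
  by (induction u) (auto simp: reduce_reduced)

lemma reduce_cancel_cons_append: "reduce (cancel_cons a u @ v) = cancel_cons a (reduce (u @ v))"
proof (cases u)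
  case (Cons b w)
  then show ?thesis by (auto simp: cancel_cons_inv)
qed simp

lemma reduce_append_left: "reduce (reduce u @ v) = reduce (u @ v)"
  by (induction u) (auto simp: reduce_cancel_cons_append)

lemma reduce_inverse: "reduce (rev (map inv_letter w) @ w) = []"
proof (induction w)
  case (Cons a w)
  have "reduce (rev (map inv_letter (a # w)) @ a # w)
      = reduce (rev (map inv_letter w) @ reduce (inv_letter a # a # w))"
    by (simp only: reduce_append_right) simp
  also have "reduce (inv_letter a # a # w) = reduce w"
    using cancel_cons_inv[of "reduce w" "inv_letter a"] by simp
  finally show ?case using Cons by (simp add: reduce_append_right)
qed simp

lemma free_group_simps [simp]:
  "carrier (free_group S) = {w. reduced w \<and> fst ` set w \<subseteq> S}"
  "u \<otimes>\<^bsub>free_group S\<^esub> v = reduce (u @ v)"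
  "\<one>\<^bsub>free_group S\<^esub> = []"
  by (simp_all add: free_group_def)

lemma group_free_group: "group (free_group S)"
proof (rule groupI)
  fix u v assume uv: "u \<in> carrier (free_group S)" "v \<in> carrier (free_group S)"
  have "fst ` set (reduce (u @ v)) \<subseteq> fst ` set (u @ v)"
    using set_reduce by (rule image_mono)
  also have "\<dots> \<subseteq> S" using uv by auto
  finally show "u \<otimes>\<^bsub>free_group S\<^esub> v \<in> carrier (free_group S)"
    by simp
next
  fix u assume u: "u \<in> carrier (free_group S)"
  let ?v = "reduce (rev (map inv_letter u))"
  have "fst ` set ?v \<subseteq> fst ` set (rev (map inv_letter u))"
    using set_reduce by (rule image_mono)
  also have "\<dots> \<subseteq> S" using u by auto
  finally have "?v \<in> carrier (free_group S)" by simp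
  moreover have "?v \<otimes>\<^bsub>free_group S\<^esub> u = \<one>\<^bsub>free_group S\<^esub>"
    by (simp add: reduce_append_left reduce_inverse)
  ultimately show "\<exists>v\<in>carrier (free_group S). v \<otimes>\<^bsub>free_group S\<^esub> u = \<one>\<^bsub>free_group S\<^esub>" by blast
qed (auto simp: reduce_append_left reduce_append_right reduce_reduced)

lemma gen_closed: "s \<in> S \<Longrightarrow> gen s \<in> carrier (free_group S)"
  by (auto simp: gen_def reduced_Cons)

lemma inv_gen: "s \<in> S \<Longrightarrow> inv\<^bsub>free_group S\<^esub> gen s = [(s, False)]"
  by (rule group.inv_equality[OF group_free_group])
     (auto simp: gen_def reduced_Cons inv_letter_def)

lemma inj_gen: "inj gen"
  by (auto simp: inj_def gen_def)

text \<open>The universal property of the free group.\<close>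

theorem free_group_universal:
  fixes G :: "('g, 'b) monoid_scheme" and f :: "'s \<Rightarrow> 'g"
  assumes G: "group G" and f: "f \<in> S \<rightarrow> carrier G"
  shows "\<exists>h. h \<in> hom (free_group S) G \<and> (\<forall>s\<in>S. h (gen s) = f s)
      \<and> (\<forall>h'\<in>hom (free_group S) G. (\<forall>s\<in>S. h' (gen s) = f s)
            \<longrightarrow> (\<forall>w\<in>carrier (free_group S). h' w = h w))"
proof -
  interpret G: group G by fact
  define l where "l a = (if snd a then f (fst a) else inv\<^bsub>G\<^esub> f (fst a))" for a :: "'s \<times> bool"
  define h where "h w = foldr (\<lambda>a x. l a \<otimes>\<^bsub>G\<^esub> x) w \<one>\<^bsub>G\<^esub>" for w
  have h_simps [simp]: "h [] = \<one>\<^bsub>G\<^esub>" "h (a # w) = l a \<otimes>\<^bsub>G\<^esub> h w" for a w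
    by (simp_all add: h_def)
  have l_closed [simp]: "fst a \<in> S \<Longrightarrow> l a \<in> carrier G" for a
    using f by (auto simp: l_def)
  have l_inv: "fst a \<in> S \<Longrightarrow> l a \<otimes>\<^bsub>G\<^esub> l (inv_letter a) = \<one>\<^bsub>G\<^esub>" for a
    using f by (auto simp: l_def inv_letter_def Pi_iff)
  have h_closed [simp]: "fst ` set w \<subseteq> S \<Longrightarrow> h w \<in> carrier G" for w
    by (induction w) auto
  have h_append: "fst ` set u \<subseteq> S \<Longrightarrow> fst ` set v \<subseteq> S \<Longrightarrow> h (u @ v) = h u \<otimes>\<^bsub>G\<^esub> h v" for u v
    by (induction u) (auto simp: G.m_assoc)
  have h_cancel: "h (cancel_cons a w) = l a \<otimes>\<^bsub>G\<^esub> h w" if "fst a \<in> S" "fst ` set w \<subseteq> S" for a w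
  proof (cases w)
    case (Cons b v)
    have "l a \<otimes>\<^bsub>G\<^esub> (l (inv_letter a) \<otimes>\<^bsub>G\<^esub> h v) = h v"
      using that Cons by (simp add: G.m_assoc[symmetric] l_inv)
    then show ?thesis using Cons by auto
  qed simp
  have h_reduce: "fst ` set w \<subseteq> S \<Longrightarrow> h (reduce w) = h w" for w
  proof (induction w)
    case (Cons a w)
    have "fst ` set (reduce w) \<subseteq> fst ` set w"
      using set_reduce by (rule image_mono)
    also have "\<dots> \<subseteq> S" using Cons.prems by simp
    finally have "fst ` set (reduce w) \<subseteq> S" .
    with Cons show ?case by (simp add: h_cancel)
  qed simp
  have hom: "h \<in> hom (free_group S) G"
    by (rule homI) (simp_all add: h_reduce h_append image_Un)
  have gens: "\<forall>s\<in>S. h (gen s) = f s"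
    using f by (auto simp: gen_def l_def Pi_iff)
  have "h' w = h w" if h': "h' \<in> hom (free_group S) G" "\<forall>s\<in>S. h' (gen s) = f s"
    and w: "w \<in> carrier (free_group S)" for h' w
  proof -
    interpret h': group_hom "free_group S" G h'
      using h' G group_free_group by (simp add: group_hom_def group_hom_axioms_def)
    have letter: "h' [a] = l a" if "fst a \<in> S" for a
    proof (cases a)
      case (Pair s b)
      with that h'(2) h'.hom_inv[of "gen s"] show ?thesis
        by (cases b) (simp_all add: l_def inv_gen gen_closed del: free_group_simps, simp add: gen_def)
    qed
    show ?thesis using w
    proof (induction w)
      case Nil
      then show ?case using h'.hom_one by simp
    next
      case (Cons a w)
      then have w: "w \<in> carrier (free_group S)" and a: "[a] \<in> carrier (free_group S)"
        by (auto simp: reduced_Cons)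
      have "a # w = [a] \<otimes>\<^bsub>free_group S\<^esub> w"
        using reduce_reduced[of "a # w"] Cons.prems by simp
      then have "h' (a # w) = h' [a] \<otimes>\<^bsub>G\<^esub> h' w"
        using h'.hom_mult[OF a w] by (simp only:)
      then show ?case using Cons.IH[OF w] letter[of a] a by simp
    qed
  qed
  with hom gens show ?thesis by blast
qed

lemma (in group) normal_closure_normal:
  assumes "R \<subseteq> carrier G"
  shows "normal_closure G R \<lhd> G"
  unfolding normal_closure_def
proof (rule normal_generateI)
  show "{g \<otimes> r \<otimes> inv g |g r. g \<in> carrier G \<and> r \<in> R} \<subseteq> carrier G"
    using assms by auto
next
  fix h g assume "h \<in> {g \<otimes> r \<otimes> inv g |g r. g \<in> carrier G \<and> r \<in> R}" and g: "g \<in> carrier G"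
  then obtain x r where h: "h = x \<otimes> r \<otimes> inv x" "x \<in> carrier G" "r \<in> R" by blast
  then have "g \<otimes> h \<otimes> inv g = (g \<otimes> x) \<otimes> r \<otimes> inv (g \<otimes> x)"
    using g assms by (auto simp: m_assoc inv_mult_group)
  with h g show "g \<otimes> h \<otimes> inv g \<in> {g \<otimes> r \<otimes> inv g |g r. g \<in> carrier G \<and> r \<in> R}"
    by blast
qed

lemma group_presented_group:
  assumes "R \<subseteq> carrier (free_group S)"
  shows "group (presented_group S R)"
  unfolding presented_group_def
  using assms by (intro normal.factorgroup_is_group group.normal_closure_normal group_free_group)

lemma group_mapping_torus:
  assumes \<phi>: "\<phi> \<in> hom (free_group (base_gens k)) (free_group (base_gens k))"
  shows "group (mapping_torus k \<phi>)"
proof -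
  let ?S = "insert Stable (base_gens k)"
  interpret F: group "free_group ?S" by (rule group_free_group)
  have "gen Stable \<otimes>\<^bsub>free_group ?S\<^esub> gen (Base i) \<otimes>\<^bsub>free_group ?S\<^esub> inv\<^bsub>free_group ?S\<^esub> gen Stable
      \<otimes>\<^bsub>free_group ?S\<^esub> inv\<^bsub>free_group ?S\<^esub> \<phi> (gen (Base i)) \<in> carrier (free_group ?S)"
    if "i \<in> {1..k}" for i
  proof -
    have "\<phi> (gen (Base i)) \<in> carrier (free_group ?S)"
      using hom_in_carrier[OF \<phi> gen_closed, of "Base i"] that by auto
    moreover have "gen Stable \<in> carrier (free_group ?S)" "gen (Base i) \<in> carrier (free_group ?S)"
      using that by (blast intro: gen_closed)+
    ultimately show ?thesis by (intro F.m_closed F.inv_closed)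
  qed
  then show ?thesis
    unfolding mapping_torus_def Let_def by (intro group_presented_group) blast
qed

end

theory Submission
  imports Defs "HOL-Library.Poly_Mapping" "HOL-Library.Z2"
begin

text \<open>
  The elements of the mapping torus have the form \<open>t\<^sup>-\<^sup>a v t\<^sup>b\<close> with \<open>v\<close> in the free group, and the
  essential case is to find, for \<open>v \<noteq> 1\<close>, a homomorphism \<open>f\<close> from the free group to a finite group
  with \<open>f (\<phi>\<^sup>j v) \<noteq> 1\<close> for all \<open>j\<close>: the sequence \<open>f \<circ> \<phi>\<^sup>j\<close> is eventually periodic, with period \<open>m\<close>
  say, and its periodic part makes the torus act on \<open>\<int>/m \<times> G\<close>.

  The homomorphism is found by the method of Borisov and Sapir. Over \<open>\<bbbF>\<^sub>2\<close>, evaluating the words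
  \<open>\<phi> x\<^sub>i\<close> at generic \<open>2 \<times> 2\<close> matrices, with adjugates as inverses, gives a polynomial map \<open>\<Phi>\<close> in
  \<open>n\<close> variables. For a large power \<open>Q\<close> of \<open>2\<close> let \<open>I\<close> be generated by all \<open>\<Phi>\<^sub>i - x\<^sub>i\<^sup>Q\<close>; then
  \<open>E \<circ> \<Phi> \<equiv> E\<^sup>Q\<close> modulo \<open>I\<close> for every polynomial \<open>E\<close>, the quotient by \<open>I\<close> has dimension \<open>Q\<^sup>n\<close>, and no
  nonzero polynomial of degree less than \<open>Q\<close> lies in \<open>I\<close>. If \<open>E\<close> were nilpotent modulo \<open>I\<close>, then
  \<open>E\<close> to the power \<open>Q\<^sup>n\<close>, and hence \<open>E \<circ> \<Phi>\<^sup>n\<close>, would lie in \<open>I\<close>; but the degree of \<open>E \<circ> \<Phi>\<^sup>n\<close> does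
  not depend on \<open>Q\<close>. So some prime ideal \<open>J \<supseteq> I\<close> avoids \<open>E\<close>, hence all \<open>E \<circ> \<Phi>\<^sup>j\<close>. Taking for \<open>E\<close> the
  product of the determinants with a polynomial that witnesses that \<open>v\<close> is not scalar, \<open>PGL\<^sub>2\<close> over
  the finite field of residues modulo \<open>J\<close> is the required group.
\<close>

section \<open>Ideals\<close>

text \<open>Quotient rings are never formed: residues are compared by membership of differences in
  the ideal.\<close>

definition ring_ideal :: "'r::comm_ring_1 set \<Rightarrow> bool" where
  "ring_ideal I \<longleftrightarrow> 0 \<in> I \<and> (\<forall>a\<in>I. \<forall>b\<in>I. a + b \<in> I) \<and> (\<forall>a\<in>I. \<forall>r. r * a \<in> I)"

definition prime_ring_ideal :: "'r::comm_ring_1 set \<Rightarrow> bool" where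
  "prime_ring_ideal J \<longleftrightarrow> ring_ideal J \<and> 1 \<notin> J \<and> (\<forall>a b. a * b \<in> J \<longrightarrow> a \<in> J \<or> b \<in> J)"

lemma ring_idealD:
  assumes "ring_ideal I"
  shows "0 \<in> I" "a \<in> I \<Longrightarrow> b \<in> I \<Longrightarrow> a + b \<in> I" "a \<in> I \<Longrightarrow> r * a \<in> I" "a \<in> I \<Longrightarrow> a * r \<in> I"
    "a \<in> I \<Longrightarrow> - a \<in> I" "a \<in> I \<Longrightarrow> b \<in> I \<Longrightarrow> a - b \<in> I"
proof -
  show *: "0 \<in> I" "a \<in> I \<Longrightarrow> b \<in> I \<Longrightarrow> a + b \<in> I" "a \<in> I \<Longrightarrow> r * a \<in> I" for a b r
    using assms by (auto simp: ring_ideal_def)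
  show **: "a \<in> I \<Longrightarrow> a * r \<in> I" for a r using *(3)[of a r] by (simp add: mult.commute)
  show ***: "a \<in> I \<Longrightarrow> - a \<in> I" for a using *(3)[of a "-1"] by simp
  show "a \<in> I \<Longrightarrow> b \<in> I \<Longrightarrow> a - b \<in> I" using *(2)[of a "-b"] ***[of b] by simp
qed

lemma ring_ideal_sum:
  assumes "ring_ideal I" "\<And>i. i \<in> A \<Longrightarrow> f i \<in> I"
  shows "sum f A \<in> I"
  using assms(2) by (induction A rule: infinite_finite_induct) (auto intro: ring_idealD[OF assms(1)])

lemma prime_ring_idealD:
  assumes "prime_ring_ideal J"
  shows "ring_ideal J" "1 \<notin> J" "a * b \<in> J \<Longrightarrow> a \<in> J \<or> b \<in> J"
  using assms by (auto simp: prime_ring_ideal_def)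

lemma prime_ring_ideal_power:
  assumes "prime_ring_ideal J" "a ^ n \<in> J"
  shows "a \<in> J"
  using assms(2) prime_ring_idealD[OF assms(1)] by (induction n) auto

text \<open>Working modulo \<open>{0}\<close> lets the projective groups below cover matrices over
  the polynomial ring itself.\<close>

lemma prime_ring_ideal_zero: "prime_ring_ideal {0 :: 'r::idom}"
  by (auto simp: prime_ring_ideal_def ring_ideal_def)

lemma ring_ideal_power_cong:
  fixes a b :: "'r::comm_ring_1"
  assumes "ring_ideal I" "a - b \<in> I"
  shows "a ^ n - b ^ n \<in> I"
proof (induction n)
  case (Suc n)
  have "a ^ Suc n - b ^ Suc n = (a - b) * a ^ n + b * (a ^ n - b ^ n)"
    by (simp add: algebra_simps)
  moreover have "(a - b) * a ^ n + b * (a ^ n - b ^ n) \<in> I"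
    using ring_idealD(2)[OF assms(1) ring_idealD(4)[OF assms] ring_idealD(3)[OF assms(1) Suc]] .
  ultimately show ?case by simp
qed (simp add: ring_idealD[OF assms(1)])

lemma ring_ideal_add_principal:
  fixes a :: "'r::comm_ring_1"
  assumes "ring_ideal J"
  shows "ring_ideal {x + r * a | x r. x \<in> J}"
  unfolding ring_ideal_def
proof (intro conjI ballI allI)
  show "0 \<in> {x + r * a | x r. x \<in> J}" using ring_idealD(1)[OF assms] by (auto intro!: exI[of _ 0])
next
  fix u v assume "u \<in> {x + r * a | x r. x \<in> J}" "v \<in> {x + r * a | x r. x \<in> J}"
  then obtain x r y s where "u = x + r * a" "v = y + s * a" "x \<in> J" "y \<in> J" by blast
  then have "u + v = (x + y) + (r + s) * a" "x + y \<in> J"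
    using ring_idealD(2)[OF assms] by (auto simp: algebra_simps)
  then show "u + v \<in> {x + r * a | x r. x \<in> J}" by blast
next
  fix u q assume "u \<in> {x + r * a | x r. x \<in> J}"
  then obtain x r where "u = x + r * a" "x \<in> J" by blast
  then have "q * u = q * x + (q * r) * a" "q * x \<in> J"
    using ring_idealD(3)[OF assms, of x q] by (simp_all add: algebra_simps)
  then show "q * u \<in> {x + r * a | x r. x \<in> J}" by blast
qed

text \<open>Zorn's lemma gives an ideal that is maximal among those containing \<open>I\<close> and
  missing every power of \<open>E\<close>; maximality makes it prime.\<close>

lemma exists_prime_ring_ideal_avoiding:
  fixes E :: "'r::comm_ring_1"
  assumes I: "ring_ideal I" and E: "\<And>j. E ^ j \<notin> I"
  obtains J where "prime_ring_ideal J" "I \<subseteq> J" "E \<notin> J"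
proof -
  define \<A> where "\<A> = {J. ring_ideal J \<and> I \<subseteq> J \<and> (\<forall>j. E ^ j \<notin> J)}"
  have "\<A> \<noteq> {}" using I E by (auto simp: \<A>_def)
  moreover have "\<Union>\<C> \<in> \<A>" if C: "\<C> \<noteq> {}" "subset.chain \<A> \<C>" for \<C>
  proof -
    have CA: "\<C> \<subseteq> \<A>" and lin: "\<And>A B. A \<in> \<C> \<Longrightarrow> B \<in> \<C> \<Longrightarrow> A \<subseteq> B \<or> B \<subseteq> A"
      using C by (auto simp: subset_chain_def)
    have Cid: "ring_ideal A" if "A \<in> \<C>" for A using CA that by (auto simp: \<A>_def)
    have "ring_ideal (\<Union>\<C>)"
      unfolding ring_ideal_def
    proof (intro conjI ballI allI)
      show "0 \<in> \<Union>\<C>" using C(1) ring_idealD(1)[OF Cid] by blast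
    next
      fix a b assume "a \<in> \<Union>\<C>" "b \<in> \<Union>\<C>"
      then obtain A B where "A \<in> \<C>" "B \<in> \<C>" "a \<in> A" "b \<in> B" by blast
      then obtain D where "D \<in> \<C>" "a \<in> D" "b \<in> D" using lin by blast
      then show "a + b \<in> \<Union>\<C>" using ring_idealD(2)[OF Cid] by blast
    next
      fix a r assume "a \<in> \<Union>\<C>"
      then show "r * a \<in> \<Union>\<C>" using ring_idealD(3)[OF Cid] by blast
    qed
    then show ?thesis using C CA unfolding \<A>_def by blast
  qed
  ultimately obtain J where J: "J \<in> \<A>" and max: "\<And>K. K \<in> \<A> \<Longrightarrow> J \<subseteq> K \<Longrightarrow> K = J"
    using subset_Zorn_nonempty[of \<A>] by metis
  have Jid: "ring_ideal J" and IJ: "I \<subseteq> J" and EJ: "\<And>j. E ^ j \<notin> J" using J by (auto simp: \<A>_def)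
  \<comment> \<open>The ideal generated by \<open>J\<close> and \<open>a\<close> is strictly larger
    than \<open>J\<close>, so by maximality it contains a power of \<open>E\<close>.\<close>
  have extend: "\<exists>j x r. x \<in> J \<and> E ^ j = x + r * a" if "a \<notin> J" for a
  proof (rule ccontr)
    assume *: "\<not> ?thesis"
    define K where "K = {x + r * a | x r. x \<in> J}"
    have "J \<subseteq> K" by (force simp: K_def intro: exI[of _ 0])
    moreover have "a \<in> K" using ring_idealD(1)[OF Jid] by (force simp: K_def intro: exI[of _ 0] exI[of _ 1])
    moreover have "K \<in> \<A>"
      using * ring_ideal_add_principal[OF Jid, of a] IJ \<open>J \<subseteq> K\<close> by (auto simp: \<A>_def K_def)
    ultimately show False using max that by blast
  qed
  have "a \<in> J \<or> b \<in> J" if ab: "a * b \<in> J" for a b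
  proof (rule ccontr)
    assume "\<not> ?thesis"
    then obtain i x r j y s where *: "x \<in> J" "E ^ i = x + r * a" "y \<in> J" "E ^ j = y + s * b"
      using extend by meson
    \<comment> \<open>In the product of the two expressions every term but the last has a factor in
      \<open>J\<close>, and the last contains \<open>a * b\<close>.\<close>
    have "E ^ (i + j) = (y + s * b) * x + r * a * y + (r * s) * (a * b)"
      by (simp add: power_add * algebra_simps)
    also have "\<dots> \<in> J"
      using ring_idealD(2)[OF Jid ring_idealD(2)[OF Jid ring_idealD(3)[OF Jid *(1)]
          ring_idealD(3)[OF Jid *(3)]] ring_idealD(3)[OF Jid ab]] .
    finally show False using EJ by blast
  qed
  then have "prime_ring_ideal J"
    using Jid EJ[of 0] by (auto simp: prime_ring_ideal_def)
  with IJ EJ[of 1] show ?thesis using that by simp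
qed

text \<open>If \<open>E\<close> has nilpotency index \<open>r\<close> modulo \<open>I\<close>, then the sums of distinct powers of \<open>E\<close> of
  exponent less than \<open>r\<close> are \<open>2 ^ r\<close> pairwise incongruent elements.\<close>

lemma nilpotency_index_bound:
  fixes E :: "'r::comm_ring_1"
  assumes I: "ring_ideal I" and T: "finite T" "card T \<le> 2 ^ d" "\<And>f. \<exists>t\<in>T. f - t \<in> I"
    and nil: "E ^ r \<in> I"
  shows "E ^ d \<in> I"
proof -
  define r0 where "r0 = (LEAST r. E ^ r \<in> I)"
  have r0: "E ^ r0 \<in> I" unfolding r0_def by (rule LeastI[of _ r]) (rule nil)
  have least: "E ^ i \<notin> I" if "i < r0" for i
    using that not_less_Least unfolding r0_def by blast
  have mono: "E ^ i \<in> I" if "r0 \<le> i" for i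
    using ring_idealD(3)[OF I r0, of "E ^ (i - r0)"] that by (simp flip: power_add)
  obtain rep where rep: "\<And>f. rep f \<in> T" "\<And>f. f - rep f \<in> I" using T(3) by metis
  have "inj_on (\<lambda>A. rep (\<Sum>i\<in>A. E ^ i)) (Pow {..<r0})"
  proof (rule inj_onI, rule ccontr)
    fix A B assume A: "A \<in> Pow {..<r0}" and B: "B \<in> Pow {..<r0}" and ne: "A \<noteq> B"
      and eq: "rep (\<Sum>i\<in>A. E ^ i) = rep (\<Sum>i\<in>B. E ^ i)"
    define c :: "nat \<Rightarrow> 'r" where "c i = of_bool (i \<in> A) - of_bool (i \<in> B)" for i
    have "(\<Sum>i\<in>A. E ^ i) - (\<Sum>i\<in>B. E ^ i) \<in> I"
      using ring_idealD(6)[OF I rep(2)[of "\<Sum>i\<in>A. E ^ i"] rep(2)[of "\<Sum>i\<in>B. E ^ i"]] eq by simp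
    moreover have "(\<Sum>i\<in>A. E ^ i) - (\<Sum>i\<in>B. E ^ i) = (\<Sum>i<r0. c i * E ^ i)"
    proof -
      have *: "(\<Sum>i\<in>A. E ^ i) = (\<Sum>i<r0. of_bool (i \<in> A) * E ^ i)" if "A \<subseteq> {..<r0}" for A
        using that by (intro sum.mono_neutral_cong_left) auto
      show ?thesis
        unfolding *[OF A[unfolded Pow_iff]] *[OF B[unfolded Pow_iff]]
        by (simp add: c_def left_diff_distrib sum_subtractf)
    qed
    ultimately have S: "(\<Sum>i<r0. c i * E ^ i) \<in> I" by simp
    \<comment> \<open>The smallest exponent at which \<open>A\<close> and \<open>B\<close> differ.
      Multiplying by \<open>E ^ (r0 - 1 - j)\<close> moves its term to exponent
      \<open>r0 - 1\<close>, the last one with a power outside \<open>I\<close>, and all later terms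
      into \<open>I\<close>.\<close>
    define j where "j = (LEAST i. (i \<in> A) \<noteq> (i \<in> B))"
    have "\<exists>i. (i \<in> A) \<noteq> (i \<in> B)" using ne by blast
    then have j: "(j \<in> A) \<noteq> (j \<in> B)" unfolding j_def by (rule LeastI_ex)
    have jr: "j < r0" using j A B by blast
    have lt: "c i = 0" if "i < j" for i
      using not_less_Least[of i "\<lambda>i. (i \<in> A) \<noteq> (i \<in> B)"] that by (auto simp: c_def j_def)
    have "E ^ (r0 - 1 - j) * (\<Sum>i<r0. c i * E ^ i) \<in> I" by (rule ring_idealD(3)[OF I S])
    also have "E ^ (r0 - 1 - j) * (\<Sum>i<r0. c i * E ^ i) = (\<Sum>i<r0. c i * E ^ (r0 - 1 - j + i))"
      by (simp add: sum_distrib_left power_add mult_ac)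
    also have "\<dots> = c j * E ^ (r0 - 1 - j + j) + (\<Sum>i\<in>{..<r0} - {j}. c i * E ^ (r0 - 1 - j + i))"
      using jr by (subst sum.remove[of _ j]) auto
    finally have *: "c j * E ^ (r0 - 1) + (\<Sum>i\<in>{..<r0} - {j}. c i * E ^ (r0 - 1 - j + i)) \<in> I"
      using jr by simp
    have "(\<Sum>i\<in>{..<r0} - {j}. c i * E ^ (r0 - 1 - j + i)) \<in> I"
    proof (rule ring_ideal_sum[OF I])
      fix i assume "i \<in> {..<r0} - {j}"
      then show "c i * E ^ (r0 - 1 - j + i) \<in> I"
        using lt[of i] ring_idealD(1)[OF I] jr
        by (cases "i < j") (auto intro!: ring_idealD(3)[OF I] mono)
    qed
    from ring_idealD(6)[OF I * this] have "c j * E ^ (r0 - 1) \<in> I" by simp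
    moreover have "c j = 1 \<or> c j = -1" using j by (auto simp: c_def)
    ultimately have "E ^ (r0 - 1) \<in> I" using ring_idealD(5)[OF I] by force
    then show False using least[of "r0 - 1"] jr by simp
  qed
  then have "card (Pow {..<r0}) \<le> card T"
    using rep(1) T(1) by (intro card_inj_on_le) auto
  then have "(2::nat) ^ r0 \<le> card T" by (simp add: card_Pow)
  also note T(2)
  finally have "r0 \<le> d" by simp
  then show ?thesis by (rule mono)
qed

section \<open>Polynomials over the field with two elements\<close>

type_synonym mpoly2 = "(nat \<Rightarrow>\<^sub>0 nat) \<Rightarrow>\<^sub>0 bit"

abbreviation "single \<equiv> Poly_Mapping.single"
abbreviation "lookup \<equiv> Poly_Mapping.lookup"
abbreviation "keys \<equiv> Poly_Mapping.keys"

abbreviation mon :: "(nat \<Rightarrow>\<^sub>0 nat) \<Rightarrow> mpoly2" where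
  "mon m \<equiv> single m 1"

definition var :: "nat \<Rightarrow> mpoly2" where
  "var i = mon (single i 1)"

text \<open>The only nonzero coefficient is 1, so a polynomial is determined by its support, and
  additive maps are given by their values on monomials.\<close>

lemma mpoly2_sum_mon: "f = (\<Sum>m\<in>keys f. mon m)" for f :: mpoly2
proof (rule poly_mapping_eqI)
  fix k
  show "lookup f k = lookup (\<Sum>m\<in>keys f. mon m) k"
    by (cases "k \<in> keys f") (auto simp: lookup_sum lookup_single when_def in_keys_iff)
qed

lemma mpoly2_induct_mon [case_names zero mon add]:
  fixes f :: mpoly2
  assumes "P 0" "\<And>m. P (mon m)" "\<And>f g. P f \<Longrightarrow> P g \<Longrightarrow> P (f + g)"
  shows "P f"
proof -
  have "P (\<Sum>m\<in>A. mon m)" if "finite A" for A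
    using that by (induction A) (use assms in auto)
  then show ?thesis using mpoly2_sum_mon[of f] by (metis finite_keys)
qed

lemma mpoly2_add_self [simp]: "f + f = 0" for f :: mpoly2
proof (rule poly_mapping_eqI)
  show "lookup (f + f) k = lookup 0 k" for k unfolding lookup_add by (cases "lookup f k") simp_all
qed

lemma mpoly2_uminus [simp]: "- f = f" for f :: mpoly2
  using mpoly2_add_self[of f] by (metis minus_unique)

lemma mon_mult: "mon m * mon m' = mon (m + m')"
  by (simp add: mult_single)

definition tdeg :: "(nat \<Rightarrow>\<^sub>0 nat) \<Rightarrow> nat" where
  "tdeg m = (\<Sum>i\<in>keys m. lookup m i)"

lemma keys_add_nat: "keys (m + m') = keys m \<union> keys m'" for m m' :: "nat \<Rightarrow>\<^sub>0 nat"
  by (auto simp: in_keys_iff lookup_add)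

lemma tdeg_superset: "finite A \<Longrightarrow> keys m \<subseteq> A \<Longrightarrow> tdeg m = (\<Sum>i\<in>A. lookup m i)"
  unfolding tdeg_def by (rule sum.mono_neutral_left) (auto simp: in_keys_iff)

lemma tdeg_add: "tdeg (m + m') = tdeg m + tdeg m'"
  using tdeg_superset[of "keys m \<union> keys m'"]
  by (simp add: keys_add_nat lookup_add sum.distrib)

lemma tdeg_single [simp]: "tdeg (single i q) = q"
  by (simp add: tdeg_def)

lemma lookup_le_tdeg: "lookup m i \<le> tdeg m"
  unfolding tdeg_def by (cases "i \<in> keys m") (auto intro: member_le_sum simp: in_keys_iff)

lemma diff_single_add:
  fixes m :: "nat \<Rightarrow>\<^sub>0 nat"
  assumes "q \<le> lookup m i"
  shows "(m - single i q) + single i q = m"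
  by (rule poly_mapping_eqI) (use assms in \<open>auto simp: lookup_add lookup_minus lookup_single when_def\<close>)

lemma var_power: "var i ^ q = mon (single i q)"
  by (induction q) (simp_all add: var_def mon_mult single_add[symmetric])

lemma mpoly2_induct [case_names zero one var add mult]:
  fixes f :: mpoly2
  assumes "P 0" "P 1" "\<And>i. P (var i)" "\<And>f g. P f \<Longrightarrow> P g \<Longrightarrow> P (f + g)"
    "\<And>f g. P f \<Longrightarrow> P g \<Longrightarrow> P (f * g)"
  shows "P f"
proof (induction f rule: mpoly2_induct_mon)
  case (mon m)
  show ?case
  proof (induction "tdeg m" arbitrary: m rule: less_induct)
    case less
    show ?case
    proof (cases "m = 0")
      case True
      then show ?thesis using assms(2) by simp
    next
      case False
      then obtain i where "lookup m i \<noteq> 0" by (metis lookup_zero poly_mapping_eqI)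
      then have m: "(m - single i 1) + single i 1 = m" by (intro diff_single_add) simp
      then have "tdeg (m - single i 1) < tdeg m" using tdeg_add[of "m - single i 1" "single i 1"] by simp
      from assms(5)[OF less[OF this] assms(3)[of i]] show ?thesis
        using m by (simp add: var_def mon_mult)
    qed
  qed
qed (use assms in auto)

section \<open>Additive extension and substitution homomorphisms\<close>

definition lin_ext :: "((nat \<Rightarrow>\<^sub>0 nat) \<Rightarrow> mpoly2) \<Rightarrow> mpoly2 \<Rightarrow> mpoly2" where
  "lin_ext h f = (\<Sum>m\<in>keys f. h m)"

lemma lin_ext_mon [simp]: "lin_ext h (mon m) = h m"
  and lin_ext_zero [simp]: "lin_ext h 0 = 0"
  by (simp_all add: lin_ext_def)

text \<open>A monomial in both supports drops out of \<open>f + g\<close>, and so do its two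
  contributions, since \<open>h m + h m = 0\<close> in characteristic 2.\<close>

lemma lin_ext_add: "lin_ext h (f + g) = lin_ext h f + lin_ext h g"
proof -
  define A where "A = keys f \<union> keys g"
  have *: "lin_ext h p = (\<Sum>m\<in>A. if lookup p m = 0 then 0 else h m)" if "keys p \<subseteq> A" for p
    unfolding lin_ext_def using that
    by (intro sum.mono_neutral_cong_left) (auto simp: A_def in_keys_iff)
  have "keys (f + g) \<subseteq> A" using keys_add[of f g] by (auto simp: A_def)
  then show ?thesis
    by (subst (1 2 3) *) (auto simp: A_def lookup_add simp flip: sum.distrib intro!: sum.cong)
qed

lemma lin_ext_sum: "lin_ext h (\<Sum>i\<in>A. f i) = (\<Sum>i\<in>A. lin_ext h (f i))"
  by (induction A rule: infinite_finite_induct) (auto simp: lin_ext_add)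

definition mon_subst :: "(nat \<Rightarrow> mpoly2) \<Rightarrow> (nat \<Rightarrow>\<^sub>0 nat) \<Rightarrow> mpoly2" where
  "mon_subst a m = (\<Prod>i\<in>keys m. a i ^ lookup m i)"

definition subst :: "(nat \<Rightarrow> mpoly2) \<Rightarrow> mpoly2 \<Rightarrow> mpoly2" where
  "subst a = lin_ext (mon_subst a)"

lemma mon_subst_superset:
  "finite A \<Longrightarrow> keys m \<subseteq> A \<Longrightarrow> mon_subst a m = (\<Prod>i\<in>A. a i ^ lookup m i)"
  unfolding mon_subst_def by (rule prod.mono_neutral_left) (auto simp: in_keys_iff)

lemma mon_subst_add: "mon_subst a (m + m') = mon_subst a m * mon_subst a m'"
  using mon_subst_superset[of "keys m \<union> keys m'"]
  by (simp add: keys_add_nat lookup_add power_add prod.distrib)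

lemma subst_zero [simp]: "subst a 0 = 0"
  and subst_one [simp]: "subst a 1 = 1"
  and subst_var [simp]: "subst a (var i) = a i"
  by (simp_all add: subst_def lin_ext_def mon_subst_def var_def)

lemma subst_add: "subst a (f + g) = subst a f + subst a g"
  by (simp add: subst_def lin_ext_add)

lemma subst_mult: "subst a (f * g) = subst a f * subst a g"
proof (induction f rule: mpoly2_induct_mon)
  case (mon m)
  show ?case
  proof (induction g rule: mpoly2_induct_mon)
    case (mon m')
    show ?case by (simp add: mon_mult) (simp add: subst_def mon_subst_add)
  qed (simp_all add: distrib_left subst_add)
qed (simp_all add: distrib_right subst_add)

lemma subst_diff: "subst a (f - g) = subst a f - subst a g"
  using subst_add[of a "f - g" g] by simp

lemma subst_prod: "subst a (\<Prod>i\<in>A. f i) = (\<Prod>i\<in>A. subst a (f i))"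
  by (induction A rule: infinite_finite_induct) (auto simp: subst_mult)

text \<open>Iterated Frobenius: the cross term of a square vanishes in characteristic 2. This is why
  \<open>Q\<close> is later chosen as a power of 2.\<close>

lemma mpoly2_power2_add: "(f + g) ^ (2 ^ s) = f ^ (2 ^ s) + g ^ (2 ^ s)" for f g :: mpoly2
proof (induction s)
  case (Suc s)
  have "(a + b) ^ 2 = a ^ 2 + b ^ 2" for a b :: mpoly2
    by (simp add: power2_sum mult_2 distrib_right)
  with Suc show ?case by (simp add: power_mult mult.commute[of 2])
qed simp

definition in_vars :: "nat \<Rightarrow> mpoly2 \<Rightarrow> bool" where
  "in_vars n f \<longleftrightarrow> (\<forall>m\<in>keys f. keys m \<subseteq> {..<n})"

lemma in_vars_zero [simp]: "in_vars n 0"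
  and in_vars_one [simp]: "in_vars n 1"
  by (simp_all add: in_vars_def)

lemma in_vars_var: "in_vars n (var i) \<longleftrightarrow> i < n"
  by (simp add: in_vars_def var_def)

lemma in_vars_add: "in_vars n f \<Longrightarrow> in_vars n g \<Longrightarrow> in_vars n (f + g)"
  using keys_add[of f g] by (auto simp: in_vars_def)

lemma in_vars_mult: "in_vars n f \<Longrightarrow> in_vars n g \<Longrightarrow> in_vars n (f * g)"
  using keys_mult[of f g] by (fastforce simp: in_vars_def keys_add_nat)

lemma in_vars_diff: "in_vars n f \<Longrightarrow> in_vars n g \<Longrightarrow> in_vars n (f - g)"
  using in_vars_add[of n f g] by (simp only: diff_conv_add_uminus mpoly2_uminus)

lemma in_vars_subst: "(\<And>i. in_vars n (a i)) \<Longrightarrow> in_vars n (subst a f)"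
  by (induction f rule: mpoly2_induct) (auto simp: subst_add subst_mult in_vars_add in_vars_mult)

section \<open>Prime ideals of quasi-fixed points\<close>

text \<open>By \<open>a_deg\<close> the rewriting rules \<open>x_i^Q -> a i\<close> lower the total
  degree, which gives termination and the inductions on \<open>tdeg\<close> below.\<close>

locale quasi_fixed_scheme =
  fixes n Q :: nat and a :: "nat \<Rightarrow> mpoly2"
  assumes Q_pos: "0 < Q"
    and a_deg: "\<And>i m. i < n \<Longrightarrow> m \<in> keys (a i) \<Longrightarrow> tdeg m < Q"
begin

text \<open>Rewriting always at the least possible index makes the normal form a function;
  independence of that choice is \<open>nf_mon_mult_power\<close>.\<close>

function nf_mon :: "(nat \<Rightarrow>\<^sub>0 nat) \<Rightarrow> mpoly2" where
  "nf_mon m = (if \<not> keys m \<subseteq> {..<n} then 0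
     else if \<forall>i. lookup m i < Q then mon m
     else let i = (LEAST i. Q \<le> lookup m i)
       in \<Sum>m'\<in>keys (mon (m - single i Q) * a i). nf_mon m')"
  by pat_completeness auto

lemma tdeg_keys_mon_mult:
  assumes "i < n" "m' \<in> keys (mon m * a i)"
  shows "tdeg m' < tdeg m + Q"
proof -
  obtain m'' where "m' = m + m''" "m'' \<in> keys (a i)"
    using keys_mult[of "mon m" "a i"] assms(2) by auto
  then show ?thesis using a_deg assms(1) by (simp add: tdeg_add)
qed

termination nf_mon
proof (relation "measure tdeg", goal_cases)
  case (2 m i m')
  then have "\<exists>i. Q \<le> lookup m i" by (auto simp: not_less)
  with 2(3) have i: "Q \<le> lookup m i" by (auto intro: LeastI_ex)
  then have "i \<in> keys m" using Q_pos by (auto simp: in_keys_iff)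
  then have "i < n" using 2(1) by auto
  moreover have "tdeg (m - single i Q) + Q = tdeg m"
    using tdeg_add[of "m - single i Q" "single i Q"] diff_single_add[OF i] by simp
  ultimately show ?case using tdeg_keys_mon_mult[of i m' "m - single i Q"] 2(4) by simp
qed simp

declare nf_mon.simps [simp del]

definition nf :: "mpoly2 \<Rightarrow> mpoly2" where
  "nf = lin_ext nf_mon"

lemma nf_zero [simp]: "nf 0 = 0"
  and nf_mon_eq [simp]: "nf (mon m) = nf_mon m"
  and nf_add: "nf (f + g) = nf f + nf g"
  by (simp_all add: nf_def lin_ext_add)

lemma nf_diff: "nf (f - g) = nf f - nf g"
  using nf_add[of "f - g" g] by simp

lemma nf_sum: "nf (\<Sum>i\<in>A. f i) = (\<Sum>i\<in>A. nf (f i))"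
  by (simp add: nf_def lin_ext_sum)

lemma nf_mult_eqI:
  assumes "\<And>m. m \<in> keys f \<Longrightarrow> nf (mon m * g) = nf (mon m * h)"
  shows "nf (f * g) = nf (f * h)"
  by (subst (1 2) mpoly2_sum_mon[of f]) (simp add: sum_distrib_right nf_sum assms)

lemma nf_mon_not_in_vars: "\<not> keys m \<subseteq> {..<n} \<Longrightarrow> nf_mon m = 0"
  by (subst nf_mon.simps) simp

lemma nf_mon_reduced: "keys m \<subseteq> {..<n} \<Longrightarrow> (\<And>i. lookup m i < Q) \<Longrightarrow> nf_mon m = mon m"
  by (subst nf_mon.simps) simp

lemma nf_mon_rewrite:
  assumes "keys m \<subseteq> {..<n}" "Q \<le> lookup m i" "\<And>j. j < i \<Longrightarrow> lookup m j < Q"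
  shows "nf_mon m = nf (mon (m - single i Q) * a i)"
proof -
  have "(LEAST i. Q \<le> lookup m i) = i"
    using assms(2,3) by (intro Least_equality) (auto simp: not_less[symmetric])
  moreover have "\<not> (\<forall>i. lookup m i < Q)" using assms(2) by (auto simp: not_less)
  ultimately show ?thesis
    using assms(1) unfolding nf_mon.simps[of m] by (simp only: if_True if_False not_True_eq_False Let_def nf_def lin_ext_def)
qed

lemma nf_mult_not_in_vars: "\<not> keys m \<subseteq> {..<n} \<Longrightarrow> nf (mon m * f) = 0"
proof (induction f rule: mpoly2_induct_mon)
  case (mon m')
  then have "\<not> keys (m + m') \<subseteq> {..<n}" by (auto simp: keys_add_nat)
  then show ?case by (simp add: mon_mult nf_mon_not_in_vars)
qed (auto simp: distrib_left nf_add)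

lemma nf_var_mult: "n \<le> i \<Longrightarrow> nf (var i * f) = 0"
  unfolding var_def by (rule nf_mult_not_in_vars) simp

text \<open>Confluence of the rewriting rules: the two rules applicable to a common multiple of
  \<open>x\<^sub>i\<^sup>Q\<close> and \<open>x\<^sub>j\<^sup>Q\<close> with \<open>i \<noteq> j\<close> act on disjoint factors.\<close>

lemma nf_mon_mult_power: "i < n \<Longrightarrow> nf (mon m * var i ^ Q) = nf (mon m * a i)"
proof (induction "tdeg m" arbitrary: m i rule: less_induct)
  case less
  define M where "M = m + single i Q"
  have M: "mon m * var i ^ Q = mon M" by (simp add: M_def var_power mon_mult)
  show ?case
  proof (cases "keys m \<subseteq> {..<n}")
    case False
    then show ?thesis by (simp add: nf_mult_not_in_vars)
  next
    case True
    have keysM: "keys M \<subseteq> {..<n}" using True less.prems by (auto simp: M_def keys_add_nat)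
    have QMi: "Q \<le> lookup M i" by (simp add: M_def lookup_add)
    define j where "j = (LEAST j. Q \<le> lookup M j)"
    have QMj: "Q \<le> lookup M j" unfolding j_def by (rule LeastI) (rule QMi)
    have least: "lookup M j' < Q" if "j' < j" for j'
      using not_less_Least[of j' "\<lambda>j. Q \<le> lookup M j"] that by (simp add: j_def)
    have rewr: "nf_mon M = nf (mon (M - single j Q) * a j)"
      by (rule nf_mon_rewrite[OF keysM QMj least])
    show ?thesis
    proof (cases "j = i")
      case True
      have "M - single i Q = m" by (simp add: M_def)
      then show ?thesis using rewr M True by simp
    next
      case False
      have jn: "j < n" using QMj Q_pos keysM by (auto simp: in_keys_iff subset_iff)
      define m' where "m' = m - single j Q"
      have "Q \<le> lookup m j" using QMj False by (simp add: M_def lookup_add lookup_single when_def)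
      then have m: "m' + single j Q = m" unfolding m'_def by (rule diff_single_add)
      have "M = m' + single i Q + single j Q" by (simp add: M_def m[symmetric] add_ac)
      then have Mj: "mon (M - single j Q) = mon m' * var i ^ Q" by (simp add: var_power mon_mult)
      have mj: "mon m = mon m' * var j ^ Q" by (simp add: m var_power mon_mult)
      have deg: "tdeg m'' < tdeg m" if "m'' \<in> keys (mon m' * a l)" "l < n" for m'' l
        using tdeg_keys_mon_mult[OF that(2,1)] tdeg_add[of m' "single j Q"] m by simp
      \<comment> \<open>The rewriting at \<open>j\<close>, prescribed by \<open>nf_mon\<close>, is
        followed by one at \<open>i\<close>, and then the one at \<open>j\<close> is undone. The
        last two concern monomials of degree below \<open>tdeg m\<close>, where the induction
        hypothesis applies.\<close>
      have "nf (mon m * var i ^ Q) = nf ((mon m' * a j) * var i ^ Q)"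
        using rewr by (simp add: M Mj mult_ac)
      also have "\<dots> = nf ((mon m' * a j) * a i)"
        by (rule nf_mult_eqI) (use deg jn less in blast)
      also have "\<dots> = nf ((mon m' * a i) * a j)" by (simp add: mult_ac)
      also have "\<dots> = nf ((mon m' * a i) * var j ^ Q)"
        by (rule nf_mult_eqI[symmetric]) (use deg jn less in blast)
      also have "\<dots> = nf (mon m * a i)" by (simp add: mj mult_ac)
      finally show ?thesis .
    qed
  qed
qed

lemma nf_mult_power: "i < n \<Longrightarrow> nf (f * var i ^ Q) = nf (f * a i)"
  by (rule nf_mult_eqI) (rule nf_mon_mult_power)

text \<open>By \<open>nf_mult_power\<close> a single rewriting inside \<open>f\<close> does not
  affect the normal form of the product; induction on the degree handles the rest. It puts
  \<open>f - nf f\<close> into the ideal.\<close>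

lemma nf_nf_mult: "nf (nf f * g) = nf (f * g)"
proof (induction f rule: mpoly2_induct_mon)
  case (mon m)
  show ?case
  proof (induction "tdeg m" arbitrary: m rule: less_induct)
    case less
    consider "\<not> keys m \<subseteq> {..<n}" | "keys m \<subseteq> {..<n}" "\<And>i. lookup m i < Q"
      | "keys m \<subseteq> {..<n}" "\<exists>i. Q \<le> lookup m i"
      by (meson not_less)
    then show ?case
    proof cases
      case 1
      then show ?thesis by (simp add: nf_mon_not_in_vars nf_mult_not_in_vars)
    next
      case 2
      then show ?thesis by (simp add: nf_mon_reduced)
    next
      case 3
      define i where "i = (LEAST i. Q \<le> lookup m i)"
      have Qi: "Q \<le> lookup m i" unfolding i_def by (rule LeastI_ex) (rule 3(2))
      have least: "lookup m j < Q" if "j < i" for j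
        using not_less_Least[of j "\<lambda>i. Q \<le> lookup m i"] that by (simp add: i_def)
      have i: "i < n" using Qi Q_pos 3(1) by (auto simp: in_keys_iff subset_iff)
      define m' where "m' = m - single i Q"
      have m: "m' + single i Q = m" unfolding m'_def using Qi by (rule diff_single_add)
      have deg: "tdeg m'' < tdeg m" if "m'' \<in> keys (mon m' * a i)" for m''
        using tdeg_keys_mon_mult[OF i that] tdeg_add[of m' "single i Q"] m by simp
      have "nf (nf (mon m) * g) = nf (nf (mon m' * a i) * g)"
        using nf_mon_rewrite[OF 3(1) Qi least] by (simp add: m'_def)
      also have "\<dots> = nf ((mon m' * a i) * g)"
      proof -
        have "nf (nf f * g) = nf (f * g)" if "\<And>m''. m'' \<in> keys f \<Longrightarrow> tdeg m'' < tdeg m" for f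
          by (subst (1 2) mpoly2_sum_mon[of f]) (simp add: sum_distrib_right nf_sum less that del: nf_mon_eq)
        then show ?thesis using deg .
      qed
      also have "\<dots> = nf (mon m' * g * a i)" by (simp add: mult_ac)
      also have "\<dots> = nf (mon m' * g * var i ^ Q)" by (rule nf_mult_power[OF i, symmetric])
      also have "\<dots> = nf ((mon m' * var i ^ Q) * g)" by (simp add: mult_ac)
      also have "\<dots> = nf (mon m * g)" by (simp add: var_power mon_mult m)
      finally show ?thesis .
    qed
  qed
qed (simp_all add: nf_add distrib_right)

text \<open>This is the ideal generated by the \<open>a i - x\<^sub>i\<^sup>Q\<close> for \<open>i < n\<close> and the \<open>x\<^sub>i\<close> for \<open>i \<ge> n\<close>. The
  definition through normal forms makes the ideal property and the independence of the reduced
  monomials immediate.\<close>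

definition quasi_fixed_ideal :: "mpoly2 set" where
  "quasi_fixed_ideal = {f. \<forall>g. nf (f * g) = 0}"

lemma ring_ideal_quasi_fixed_ideal: "ring_ideal quasi_fixed_ideal"
proof -
  have "nf (r * f * g) = 0" if "\<forall>g. nf (f * g) = 0" for r f g
    using that[rule_format, of "r * g"] by (simp add: mult_ac)
  then show ?thesis by (auto simp: ring_ideal_def quasi_fixed_ideal_def nf_add distrib_right)
qed

lemma power_minus_in_ideal: "i < n \<Longrightarrow> a i - var i ^ Q \<in> quasi_fixed_ideal"
  using nf_mult_power[of i] by (simp add: quasi_fixed_ideal_def right_diff_distrib nf_diff mult.commute[of "a i - _"])

lemma var_in_ideal: "n \<le> i \<Longrightarrow> var i \<in> quasi_fixed_ideal"
  by (simp add: quasi_fixed_ideal_def nf_var_mult)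

lemma minus_nf_in_ideal: "f - nf f \<in> quasi_fixed_ideal"
  by (simp add: quasi_fixed_ideal_def left_diff_distrib nf_diff nf_nf_mult)

text \<open>All exponents are below \<open>Q\<close>, so \<open>f\<close> is its own normal form,
  and the defining condition of the ideal fails for the cofactor 1.\<close>

lemma reduced_not_in_ideal:
  assumes "in_vars n f" "\<And>m. m \<in> keys f \<Longrightarrow> tdeg m < Q" "f \<noteq> 0"
  shows "f \<notin> quasi_fixed_ideal"
proof
  assume "f \<in> quasi_fixed_ideal"
  then have "nf (f * 1) = 0" by (simp only: quasi_fixed_ideal_def mem_Collect_eq)
  moreover have "nf f = f"
  proof -
    have "nf_mon m = mon m" if "m \<in> keys f" for m
      using assms(1) le_less_trans[OF lookup_le_tdeg assms(2)[OF that]] that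
      by (intro nf_mon_reduced) (auto simp: in_vars_def)
    then show ?thesis using mpoly2_sum_mon[of f] by (simp add: nf_def lin_ext_def)
  qed
  ultimately show False using assms(3) by simp
qed

section \<open>Counting residues modulo the quasi-fixed ideal\<close>

definition reduced_mons :: "(nat \<Rightarrow>\<^sub>0 nat) set" where
  "reduced_mons = {m. keys m \<subseteq> {..<n} \<and> (\<forall>i. lookup m i < Q)}"

lemma finite_reduced_mons: "finite reduced_mons"
  and card_reduced_mons: "card reduced_mons \<le> Q ^ n"
proof -
  let ?r = "\<lambda>m. restrict (lookup m) {..<n}"
  have inj: "inj_on ?r reduced_mons"
  proof (rule inj_onI, rule poly_mapping_eqI)
    fix m m' k assume *: "m \<in> reduced_mons" "m' \<in> reduced_mons" "?r m = ?r m'"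
    show "lookup m k = lookup m' k"
    proof (cases "k < n")
      case True
      then show ?thesis using fun_cong[OF *(3), of k] by simp
    next
      case False
      then have "k \<notin> keys m" "k \<notin> keys m'" using * by (auto simp: reduced_mons_def)
      then show ?thesis by (simp add: in_keys_iff)
    qed
  qed
  have sub: "?r ` reduced_mons \<subseteq> {..<n} \<rightarrow>\<^sub>E {..<Q}"
    by (intro image_subsetI PiE_I) (auto simp: reduced_mons_def)
  have fin: "finite ({..<n} \<rightarrow>\<^sub>E {..<Q})" by (intro finite_PiE) auto
  show "finite reduced_mons" using inj_on_finite[OF inj sub fin] .
  show "card reduced_mons \<le> Q ^ n" using card_inj_on_le[OF inj sub fin] by (simp add: card_PiE)
qed

definition reduced_polys :: "mpoly2 set" where
  "reduced_polys = (\<lambda>A. \<Sum>m\<in>A. mon m) ` Pow reduced_mons"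

lemma finite_reduced_polys: "finite reduced_polys"
  by (simp add: reduced_polys_def finite_reduced_mons)

text \<open>The size bound that \<open>nilpotency_index_bound\<close> requires, with
  \<open>d = Q ^ n\<close>.\<close>

lemma card_reduced_polys: "card reduced_polys \<le> 2 ^ (Q ^ n)"
proof -
  have "card reduced_polys \<le> card (Pow reduced_mons)"
    unfolding reduced_polys_def by (rule card_image_le) (simp add: finite_reduced_mons)
  also have "\<dots> = 2 ^ card reduced_mons" by (simp add: card_Pow finite_reduced_mons)
  also have "\<dots> \<le> 2 ^ (Q ^ n)" by (rule power_increasing[OF card_reduced_mons]) simp
  finally show ?thesis .
qed

lemma keys_nf_mon: "keys (nf_mon m) \<subseteq> reduced_mons"
proof (induction m rule: nf_mon.induct)
  case (1 m)
  show ?case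
  proof (subst nf_mon.simps, simp add: Let_def, intro conjI impI)
    assume *: "keys m \<subseteq> {..<n}" "\<forall>i. lookup m i < Q"
    then show "m \<in> reduced_mons" by (simp add: reduced_mons_def)
  next
    define i where "i = (LEAST i. Q \<le> lookup m i)"
    assume *: "keys m \<subseteq> {..<n}" "\<exists>i. \<not> lookup m i < Q"
    show "keys (\<Sum>m'\<in>keys (mon (m - single (LEAST i. Q \<le> lookup m i) Q) *
            a (LEAST i. Q \<le> lookup m i)). nf_mon m') \<subseteq> reduced_mons"
      using 1[OF _ _ refl] * keys_sum by fastforce
  qed
qed

lemma nf_reduced: "nf f \<in> reduced_polys"
proof -
  have "keys (nf f) \<subseteq> (\<Union>m\<in>keys f. keys (nf_mon m))"
    unfolding nf_def lin_ext_def by (rule keys_sum)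
  then have "keys (nf f) \<subseteq> reduced_mons" using keys_nf_mon by blast
  then show ?thesis
    unfolding reduced_polys_def using mpoly2_sum_mon[of "nf f"] by blast
qed

end

text \<open>Substitution and, by Frobenius, the power \<open>2 ^ s\<close> are both ring
  homomorphisms; they agree on the variables modulo \<open>I\<close>, hence everywhere.\<close>

lemma subst_minus_power_in_ideal:
  assumes "ring_ideal I" "\<And>i. a i - var i ^ 2 ^ s \<in> I"
  shows "subst a f - f ^ 2 ^ s \<in> I"
proof (induction f rule: mpoly2_induct)
  case (add f g)
  then show ?case
    using ring_idealD(2)[OF assms(1) add] by (simp add: subst_add mpoly2_power2_add algebra_simps)
next
  case (mult f g)
  have "subst a (f * g) - (f * g) ^ 2 ^ s
      = subst a g * (subst a f - f ^ 2 ^ s) + f ^ 2 ^ s * (subst a g - g ^ 2 ^ s)"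
    by (simp add: subst_mult power_mult_distrib algebra_simps)
  then show ?case
    using ring_idealD(2)[OF assms(1) ring_idealD(3)[OF assms(1) mult(1)] ring_idealD(3)[OF assms(1) mult(2)]]
    by simp
qed (use assms(2) ring_idealD(1)[OF assms(1)] in \<open>simp_all add: power_0_left\<close>)

lemma subst_funpow_minus_power_in_ideal:
  assumes "ring_ideal I" "\<And>i. a i - var i ^ 2 ^ s \<in> I"
  shows "(subst a ^^ j) f - f ^ (2 ^ s) ^ j \<in> I"
proof (induction j)
  case (Suc j)
  let ?g = "(subst a ^^ j) f"
  \<comment> \<open>The congruence is applied to the outermost substitution, at \<open>?g\<close>;
    the induction hypothesis is raised to the power \<open>2 ^ s\<close>.\<close>
  have "(subst a ?g - ?g ^ 2 ^ s) + (?g ^ 2 ^ s - (f ^ (2 ^ s) ^ j) ^ 2 ^ s) \<in> I"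
    by (intro ring_idealD(2) assms(1) subst_minus_power_in_ideal[OF assms] ring_ideal_power_cong Suc)
  moreover have "(f ^ (2 ^ s) ^ j) ^ 2 ^ s = f ^ (2 ^ s) ^ Suc j"
    by (simp flip: power_mult add: mult.commute)
  ultimately show ?case by (simp only: diff_add_eq_diff_diff_swap add_diff_eq diff_add_cancel funpow.simps comp_apply)
qed (simp add: ring_idealD(1)[OF assms(1)])

text \<open>\<open>T\<close> represents all residues, so the residue ring modulo \<open>J\<close> is
  a finite domain. Modulo \<open>J\<close> the iterated substitutions are Frobenius powers, so they
  preserve the complement of the prime ideal.\<close>

theorem exists_finite_quasi_fixed_prime:
  fixes a :: "nat \<Rightarrow> mpoly2"
  assumes vars: "\<And>i. in_vars n (a i)" "\<And>i. n \<le> i \<Longrightarrow> a i = 0"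
    and E: "in_vars n E" "(subst a ^^ n) E \<noteq> 0"
  obtains J T where "prime_ring_ideal J" "finite T" "\<And>f. \<exists>t\<in>T. f - t \<in> J"
    "\<And>j f. f \<notin> J \<Longrightarrow> (subst a ^^ j) f \<notin> J" "E \<notin> J"
proof -
  let ?E = "(subst a ^^ n) E"
  \<comment> \<open>\<open>Q\<close> must exceed the degrees of the \<open>a i\<close> for
    termination, and those of \<open>?E\<close> to keep \<open>?E\<close> out of the ideal; these
    degrees are fixed before \<open>Q\<close> is chosen.\<close>
  define D where "D = (\<Union>i<n. tdeg ` keys (a i)) \<union> tdeg ` keys ?E"
  have "finite D" by (simp add: D_def)
  then obtain s where s: "\<forall>d\<in>D. d < s" using finite_nat_set_iff_bounded by blast
  define Q :: nat where "Q = 2 ^ s"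
  have DQ: "d < Q" if "d \<in> D" for d
    using s that less_exp[of s] unfolding Q_def by (meson less_trans)
  interpret quasi_fixed_scheme n Q a
    by unfold_locales (use DQ in \<open>auto simp: D_def Q_def\<close>)
  let ?I = "quasi_fixed_ideal"
  note I = ring_ideal_quasi_fixed_ideal
  have gens: "a i - var i ^ 2 ^ s \<in> ?I" for i
  proof (cases "i < n")
    case True
    then show ?thesis using power_minus_in_ideal unfolding Q_def by blast
  next
    case False
    \<comment> \<open>Here \<open>a i = 0\<close>, and \<open>x_i^Q\<close> is a multiple of
      \<open>x_i\<close>, which lies in the ideal.\<close>
    then have "var i * var i ^ (2 ^ s - 1) \<in> ?I"
      using var_in_ideal by (intro ring_idealD(4)[OF I]) simp
    then show ?thesis using False vars(2)[of i] by (simp flip: power_Suc)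
  qed
  have "in_vars n ?E"
    by (cases n) (use E(1) vars(1) in \<open>auto intro!: in_vars_subst\<close>)
  then have "?E \<notin> ?I" using DQ E(2) by (intro reduced_not_in_ideal) (auto simp: D_def)
  moreover have "?E - E ^ Q ^ n \<in> ?I"
    using subst_funpow_minus_power_in_ideal[OF I gens] by (simp only: Q_def)
  ultimately have "E ^ Q ^ n \<notin> ?I" using ring_idealD(2)[OF I] by (metis diff_add_cancel)
  moreover have "\<exists>t\<in>reduced_polys. f - t \<in> ?I" for f
    using minus_nf_in_ideal nf_reduced by blast
  \<comment> \<open>If any power of \<open>E\<close> were in the ideal,
    \<open>nilpotency_index_bound\<close> would put \<open>E ^ Q ^ n\<close> there.\<close>
  ultimately have "E ^ r \<notin> ?I" for r
    using nilpotency_index_bound[OF I finite_reduced_polys card_reduced_polys] by blast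
  then obtain J where J: "prime_ring_ideal J" "?I \<subseteq> J" "E \<notin> J"
    using exists_prime_ring_ideal_avoiding[OF I] by blast
  show ?thesis
  proof (rule that[of J reduced_polys])
    show "(subst a ^^ j) f \<notin> J" if "f \<notin> J" for f j
    proof
      note Jid = prime_ring_idealD(1)[OF J(1)]
      assume *: "(subst a ^^ j) f \<in> J"
      have "(subst a ^^ j) f - f ^ (2 ^ s) ^ j \<in> J"
        using gens J(2) by (intro subst_funpow_minus_power_in_ideal[OF Jid]) blast
      from ring_idealD(6)[OF Jid * this] have "f ^ (2 ^ s) ^ j \<in> J" by simp
      then show False using that prime_ring_ideal_power[OF J(1)] by blast
    qed
  next
    fix f
    show "\<exists>t\<in>reduced_polys. f - t \<in> J"
      using minus_nf_in_ideal nf_reduced J(2) by blast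
  qed (use J finite_reduced_polys in auto)
qed

section \<open>Projective linear groups and words in matrices\<close>

datatype 'r mat2 = Mat (m11: 'r) (m12: 'r) (m21: 'r) (m22: 'r)

definition mat_one :: "'r::comm_ring_1 mat2" where
  "mat_one = Mat 1 0 0 1"

definition mat_mult :: "'r::comm_ring_1 mat2 \<Rightarrow> 'r mat2 \<Rightarrow> 'r mat2" where
  "mat_mult A B = Mat (m11 A * m11 B + m12 A * m21 B) (m11 A * m12 B + m12 A * m22 B)
                      (m21 A * m11 B + m22 A * m21 B) (m21 A * m12 B + m22 A * m22 B)"

definition mat_scale :: "'r::comm_ring_1 \<Rightarrow> 'r mat2 \<Rightarrow> 'r mat2" where
  "mat_scale c A = Mat (c * m11 A) (c * m12 A) (c * m21 A) (c * m22 A)"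

text \<open>The adjugate: an inverse up to the factor \<open>mat_det A\<close>, with entries
  polynomial in those of \<open>A\<close>.\<close>

definition adj :: "'r::comm_ring_1 mat2 \<Rightarrow> 'r mat2" where
  "adj A = Mat (m22 A) (- m12 A) (- m21 A) (m11 A)"

definition mat_det :: "'r::comm_ring_1 mat2 \<Rightarrow> 'r" where
  "mat_det A = m11 A * m22 A - m12 A * m21 A"

lemmas mat_defs = mat_one_def mat_mult_def mat_scale_def adj_def mat_det_def

lemma mat_one_mult [simp]: "mat_mult mat_one A = A" "mat_mult A mat_one = A"
  by (simp_all add: mat_defs)

lemma mat_mult_assoc: "mat_mult (mat_mult A B) C = mat_mult A (mat_mult B C)"
  by (simp add: mat_defs algebra_simps)

lemma adj_adj [simp]: "adj (adj A) = A"
  by (simp add: mat_defs)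

lemma adj_mult: "adj (mat_mult A B) = mat_mult (adj B) (adj A)"
  by (simp add: mat_defs algebra_simps)

lemma adj_one [simp]: "adj mat_one = mat_one"
  by (simp add: mat_defs)

lemma mat_mult_adj: "mat_mult A (adj A) = mat_scale (mat_det A) mat_one"
  and adj_mat_mult: "mat_mult (adj A) A = mat_scale (mat_det A) mat_one"
  by (simp_all add: mat_defs algebra_simps)

lemma mat_scale_mult: "mat_mult (mat_scale c A) B = mat_scale c (mat_mult A B)"
  and mat_mult_scale: "mat_mult A (mat_scale c B) = mat_scale c (mat_mult A B)"
  by (simp_all add: mat_defs algebra_simps)

lemma mat_det_one [simp]: "mat_det mat_one = 1"
  and mat_det_mult: "mat_det (mat_mult A B) = mat_det A * mat_det B"
  and mat_det_adj [simp]: "mat_det (adj A) = mat_det A"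
  by (simp_all add: mat_defs algebra_simps)

definition scalar_mod :: "'r::comm_ring_1 set \<Rightarrow> 'r mat2 \<Rightarrow> bool" where
  "scalar_mod J A \<longleftrightarrow> m12 A \<in> J \<and> m21 A \<in> J \<and> m11 A - m22 A \<in> J"

lemma scalar_mod_scale: "ring_ideal J \<Longrightarrow> scalar_mod J A \<Longrightarrow> scalar_mod J (mat_scale c A)"
  using ring_idealD(3)[of J "m11 A - m22 A" c] ring_idealD(3)[of J "m12 A" c]
    ring_idealD(3)[of J "m21 A" c]
  by (simp add: scalar_mod_def mat_scale_def right_diff_distrib)

lemma scalar_mod_scaleD:
  assumes "prime_ring_ideal J" "c \<notin> J" "scalar_mod J (mat_scale c A)"
  shows "scalar_mod J A"
  using assms(2,3) prime_ring_idealD(3)[OF assms(1), of c]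
  by (auto simp: scalar_mod_def mat_scale_def simp flip: right_diff_distrib)

lemma scalar_mod_one: "ring_ideal J \<Longrightarrow> scalar_mod J mat_one"
  by (simp add: scalar_mod_def mat_one_def ring_idealD(1))

lemma scalar_mod_adj: "ring_ideal J \<Longrightarrow> scalar_mod J A \<Longrightarrow> scalar_mod J (adj A)"
  using ring_idealD(5)[of J "m11 A - m22 A"] ring_idealD(5)[of J "m12 A"] ring_idealD(5)[of J "m21 A"]
  by (simp add: scalar_mod_def adj_def)

text \<open>Modulo \<open>J\<close> the matrix \<open>S\<close> is \<open>m22 S\<close> times the
  identity, so \<open>A S B\<close> is congruent to that multiple of \<open>A B\<close>.
  Transitivity of \<open>proj_rel\<close> and its compatibility with products rest on this.\<close>

lemma scalar_mod_sandwich: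
  assumes J: "ring_ideal J" and S: "scalar_mod J S" and AB: "scalar_mod J (mat_mult A B)"
  shows "scalar_mod J (mat_mult A (mat_mult S B))"
proof -
  let ?s = "m11 S - m22 S"
  have *: "?s * x + m12 S * y + m21 S * z \<in> J" for x y z
    using S by (intro ring_idealD(2)[OF J] ring_idealD(4)[OF J]) (auto simp: scalar_mod_def)
  have C: "m22 S * m12 (mat_mult A B) \<in> J" "m22 S * m21 (mat_mult A B) \<in> J"
    "m22 S * (m11 (mat_mult A B) - m22 (mat_mult A B)) \<in> J"
    using AB by (auto simp: scalar_mod_def intro: ring_idealD(3)[OF J])
  have "m12 (mat_mult A (mat_mult S B)) = m22 S * m12 (mat_mult A B)
      + (?s * (m11 A * m12 B) + m12 S * (m11 A * m22 B) + m21 S * (m12 A * m12 B))"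
    by (simp add: mat_defs algebra_simps)
  moreover have "m21 (mat_mult A (mat_mult S B)) = m22 S * m21 (mat_mult A B)
      + (?s * (m21 A * m11 B) + m12 S * (m21 A * m21 B) + m21 S * (m22 A * m11 B))"
    by (simp add: mat_defs algebra_simps)
  moreover have "m11 (mat_mult A (mat_mult S B)) - m22 (mat_mult A (mat_mult S B))
      = m22 S * (m11 (mat_mult A B) - m22 (mat_mult A B))
      + (?s * (m11 A * m11 B - m21 A * m12 B) + m12 S * (m11 A * m21 B - m21 A * m22 B)
         + m21 S * (m12 A * m11 B - m22 A * m12 B))"
    by (simp add: mat_defs algebra_simps)
  ultimately show ?thesis
    using ring_idealD(2)[OF J C(1) *] ring_idealD(2)[OF J C(2) *] ring_idealD(2)[OF J C(3) *]
    by (simp add: scalar_mod_def)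
qed

section \<open>Projective linear groups modulo a prime ideal\<close>

definition proj_rel :: "'r::comm_ring_1 set \<Rightarrow> ('r mat2 \<times> 'r mat2) set" where
  "proj_rel J = {(A, B). mat_det A \<notin> J \<and> mat_det B \<notin> J \<and> scalar_mod J (mat_mult A (adj B))}"

abbreviation proj_class :: "'r::comm_ring_1 set \<Rightarrow> 'r mat2 \<Rightarrow> 'r mat2 set" where
  "proj_class J A \<equiv> proj_rel J `` {A}"

text \<open>For prime \<open>J\<close> this is \<open>PGL_2\<close> over the fraction field of the
  residue ring, since scalars can clear denominators; \<open>adj\<close> replaces inversion.\<close>

definition proj_linear_group :: "'r::comm_ring_1 set \<Rightarrow> 'r mat2 set monoid" where
  "proj_linear_group J =
    \<lparr>carrier = {A. mat_det A \<notin> J} // proj_rel J,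
     monoid.mult = (\<lambda>C D. \<Union>A\<in>C. \<Union>B\<in>D. proj_class J (mat_mult A B)),
     one = proj_class J mat_one\<rparr>"

context
  fixes J :: "'r::comm_ring_1 set"
  assumes J: "prime_ring_ideal J"
begin

lemmas ideal_J = prime_ring_idealD(1)[OF J]

lemma mat_det_mult_notin: "mat_det A \<notin> J \<Longrightarrow> mat_det B \<notin> J \<Longrightarrow> mat_det (mat_mult A B) \<notin> J"
  using prime_ring_idealD(3)[OF J] by (auto simp: mat_det_mult)

lemma equiv_proj_rel: "equiv {A. mat_det A \<notin> J} (proj_rel J)"
proof (rule equivI)
  show "refl_on {A. mat_det A \<notin> J} (proj_rel J)"
    by (rule refl_onI)
       (simp add: proj_rel_def mat_mult_adj scalar_mod_scale[OF ideal_J scalar_mod_one[OF ideal_J]])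
  show "sym (proj_rel J)"
  proof (rule symI)
    fix A B assume "(A, B) \<in> proj_rel J"
    then show "(B, A) \<in> proj_rel J"
      using scalar_mod_adj[OF ideal_J, of "mat_mult A (adj B)"] by (simp add: proj_rel_def adj_mult)
  qed
  show "trans (proj_rel J)"
  proof (rule transI)
    fix A B C assume "(A, B) \<in> proj_rel J" "(B, C) \<in> proj_rel J"
    then have *: "mat_det A \<notin> J" "mat_det B \<notin> J" "mat_det C \<notin> J"
      "scalar_mod J (mat_mult A (adj B))" "scalar_mod J (mat_mult B (adj C))"
      by (auto simp: proj_rel_def)
    \<comment> \<open>The product is \<open>mat_det B\<close> times \<open>A adj C\<close>, and this
      factor can be cancelled because \<open>J\<close> is prime.\<close>
    have "scalar_mod J (mat_mult (mat_mult A (adj B)) (mat_mult (mat_mult B (adj C)) mat_one))"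
      using * by (intro scalar_mod_sandwich ideal_J) simp_all
    also have "mat_mult (mat_mult A (adj B)) (mat_mult (mat_mult B (adj C)) mat_one)
        = mat_mult A (mat_mult (mat_mult (adj B) B) (adj C))"
      by (simp add: mat_mult_assoc)
    also have "\<dots> = mat_scale (mat_det B) (mat_mult A (adj C))"
      by (simp add: adj_mat_mult mat_scale_mult mat_mult_scale)
    finally show "(A, C) \<in> proj_rel J"
      using scalar_mod_scaleD[OF J *(2)] *(1,3) by (simp add: proj_rel_def)
  qed
qed (auto simp: proj_rel_def)

lemma proj_class_eq_iff:
  "mat_det A \<notin> J \<Longrightarrow> mat_det B \<notin> J \<Longrightarrow>
    proj_class J A = proj_class J B \<longleftrightarrow> scalar_mod J (mat_mult A (adj B))"
  by (subst eq_equiv_class_iff[OF equiv_proj_rel]) (auto simp: proj_rel_def)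

lemma proj_class_mult_cong:
  assumes "(A, A') \<in> proj_rel J" "(B, B') \<in> proj_rel J"
  shows "proj_class J (mat_mult A B) = proj_class J (mat_mult A' B')"
proof -
  have "scalar_mod J (mat_mult A (mat_mult (mat_mult B (adj B')) (adj A')))"
    using assms by (intro scalar_mod_sandwich ideal_J) (auto simp: proj_rel_def)
  then show ?thesis
    using assms by (subst proj_class_eq_iff)
      (auto simp: proj_rel_def mat_det_mult_notin adj_mult mat_mult_assoc)
qed

lemma proj_class_in_carrier [simp]:
  "mat_det A \<notin> J \<Longrightarrow> proj_class J A \<in> carrier (proj_linear_group J)"
  by (simp add: proj_linear_group_def quotientI)

lemma proj_linear_group_carrierE:
  assumes "C \<in> carrier (proj_linear_group J)"
  obtains A where "C = proj_class J A" "mat_det A \<notin> J"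
  using assms by (auto simp: proj_linear_group_def elim: quotientE)

lemma proj_class_mult [simp]:
  assumes "mat_det A \<notin> J" "mat_det B \<notin> J"
  shows "proj_class J A \<otimes>\<^bsub>proj_linear_group J\<^esub> proj_class J B = proj_class J (mat_mult A B)"
proof -
  have "congruent2 (proj_rel J) (proj_rel J) (\<lambda>A B. proj_class J (mat_mult A B))"
    by (rule congruent2I') (rule proj_class_mult_cong)
  from UN_equiv_class2[OF equiv_proj_rel equiv_proj_rel this] show ?thesis
    using assms by (simp add: proj_linear_group_def)
qed

lemma proj_linear_group_one [simp]: "\<one>\<^bsub>proj_linear_group J\<^esub> = proj_class J mat_one"
  by (simp add: proj_linear_group_def)

lemma mat_det_one_notin: "mat_det mat_one \<notin> J"
  using prime_ring_idealD(2)[OF J] by simp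

lemma proj_class_scale:
  assumes "c \<notin> J" "mat_det A \<notin> J"
  shows "proj_class J (mat_scale c A) = proj_class J A"
proof (subst proj_class_eq_iff)
  have "mat_det (mat_scale c A) = c * (c * mat_det A)" by (simp add: mat_defs algebra_simps)
  then show "mat_det (mat_scale c A) \<notin> J" using assms prime_ring_idealD(3)[OF J] by auto
  show "scalar_mod J (mat_mult (mat_scale c A) (adj A))"
    by (simp add: mat_scale_mult mat_mult_adj scalar_mod_scale scalar_mod_one ideal_J)
qed (use assms in auto)

lemma group_proj_linear_group: "group (proj_linear_group J)"
proof (rule groupI)
  fix C assume "C \<in> carrier (proj_linear_group J)"
  then obtain A where A: "C = proj_class J A" "mat_det A \<notin> J" by (rule proj_linear_group_carrierE)
  have "proj_class J (adj A) \<otimes>\<^bsub>proj_linear_group J\<^esub> C = \<one>\<^bsub>proj_linear_group J\<^esub>"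
    using A proj_class_scale[OF _ mat_det_one_notin, of "mat_det A"] by (simp add: adj_mat_mult)
  then show "\<exists>D\<in>carrier (proj_linear_group J). D \<otimes>\<^bsub>proj_linear_group J\<^esub> C = \<one>\<^bsub>proj_linear_group J\<^esub>"
    using A by (intro bexI[of _ "proj_class J (adj A)"]) auto
next
  fix C D E assume "C \<in> carrier (proj_linear_group J)" "D \<in> carrier (proj_linear_group J)"
    "E \<in> carrier (proj_linear_group J)"
  then obtain A B F where *: "C = proj_class J A" "mat_det A \<notin> J" "D = proj_class J B" "mat_det B \<notin> J"
    "E = proj_class J F" "mat_det F \<notin> J"
    by (elim proj_linear_group_carrierE)
  show "C \<otimes>\<^bsub>proj_linear_group J\<^esub> D \<otimes>\<^bsub>proj_linear_group J\<^esub> E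
      = C \<otimes>\<^bsub>proj_linear_group J\<^esub> (D \<otimes>\<^bsub>proj_linear_group J\<^esub> E)"
    unfolding * using *(2,4,6) by (simp add: mat_det_mult_notin mat_mult_assoc)
next
  fix C D assume "C \<in> carrier (proj_linear_group J)" "D \<in> carrier (proj_linear_group J)"
  then obtain A B where *: "C = proj_class J A" "mat_det A \<notin> J" "D = proj_class J B" "mat_det B \<notin> J"
    by (elim proj_linear_group_carrierE)
  show "C \<otimes>\<^bsub>proj_linear_group J\<^esub> D \<in> carrier (proj_linear_group J)"
    unfolding * using *(2,4) by (simp add: mat_det_mult_notin)
next
  show "\<one>\<^bsub>proj_linear_group J\<^esub> \<in> carrier (proj_linear_group J)"
    unfolding proj_linear_group_one using mat_det_one_notin by (rule proj_class_in_carrier)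
next
  fix C assume "C \<in> carrier (proj_linear_group J)"
  then obtain A where *: "C = proj_class J A" "mat_det A \<notin> J" by (rule proj_linear_group_carrierE)
  have "mat_det mat_one \<notin> J" by (rule mat_det_one_notin)
  then show "\<one>\<^bsub>proj_linear_group J\<^esub> \<otimes>\<^bsub>proj_linear_group J\<^esub> C = C"
    unfolding * proj_linear_group_one using *(2) by (simp del: mat_det_one)
qed

lemma proj_class_eq_one_iff:
  "mat_det A \<notin> J \<Longrightarrow> proj_class J A = \<one>\<^bsub>proj_linear_group J\<^esub> \<longleftrightarrow> scalar_mod J A"
  unfolding proj_linear_group_one by (subst proj_class_eq_iff) (simp_all only: mat_det_one_notin adj_one mat_one_mult not_False_eq_True)

text \<open>The class of a matrix depends only on the residues of its four entries, so quadruples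
  from \<open>T\<close> suffice to name all classes.\<close>

lemma finite_proj_linear_group:
  assumes T: "finite T" "\<And>x. \<exists>t\<in>T. x - t \<in> J"
  shows "finite (carrier (proj_linear_group J))"
proof -
  obtain rep where rep: "\<And>x. rep x \<in> T" "\<And>x. x - rep x \<in> J" using T(2) by metis
  define g where "g A = (rep (m11 A), rep (m12 A), rep (m21 A), rep (m22 A))" for A
  define pick where "pick \<tau> = (SOME A. mat_det A \<notin> J \<and> g A = \<tau>)" for \<tau>
  have cong: "x - y \<in> J" if "rep x = rep y" for x y
    using ring_idealD(6)[OF ideal_J rep(2)[of x] rep(2)[of y]] that by simp
  have "C \<in> (\<lambda>\<tau>. proj_class J (pick \<tau>)) ` (T \<times> T \<times> T \<times> T)"
    if C: "C \<in> carrier (proj_linear_group J)" for C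
  proof -
    obtain A where A: "C = proj_class J A" "mat_det A \<notin> J"
      using C by (rule proj_linear_group_carrierE)
    define B where "B = pick (g A)"
    have B: "mat_det B \<notin> J \<and> g B = g A"
      using someI[of "\<lambda>B. mat_det B \<notin> J \<and> g B = g A" A] A(2) by (simp add: B_def pick_def)
    then have d: "m11 A - m11 B \<in> J" "m12 A - m12 B \<in> J" "m21 A - m21 B \<in> J" "m22 A - m22 B \<in> J"
      by (simp_all add: g_def cong)
    have 1: "m12 (mat_mult A (adj B)) = m11 B * (m12 A - m12 B) - m12 B * (m11 A - m11 B)"
      and 2: "m21 (mat_mult A (adj B)) = m22 B * (m21 A - m21 B) - m21 B * (m22 A - m22 B)"
      and 3: "m11 (mat_mult A (adj B)) - m22 (mat_mult A (adj B))
        = (m22 B * (m11 A - m11 B) - m21 B * (m12 A - m12 B))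
          - (m11 B * (m22 A - m22 B) - m12 B * (m21 A - m21 B))"
      by (simp_all add: mat_defs algebra_simps)
    note m = d[THEN ring_idealD(3)[OF ideal_J]] and minus = ring_idealD(6)[OF ideal_J]
    have "scalar_mod J (mat_mult A (adj B))"
      unfolding scalar_mod_def 1 2 3
      by (intro conjI minus[OF m(2) m(1)] minus[OF m(3) m(4)] minus[OF minus[OF m(1) m(2)] minus[OF m(4) m(3)]])
    then have "C = proj_class J B"
      using proj_class_eq_iff[OF A(2) conjunct1[OF B]] A(1) by blast
    moreover have "g A \<in> T \<times> T \<times> T \<times> T" by (simp add: g_def rep)
    ultimately show ?thesis unfolding B_def by (rule image_eqI)
  qed
  then have "carrier (proj_linear_group J) \<subseteq> (\<lambda>\<tau>. proj_class J (pick \<tau>)) ` (T \<times> T \<times> T \<times> T)"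
    by (rule subsetI)
  then show ?thesis by (rule finite_subset) (simp add: T(1))
qed

end

section \<open>Evaluating words at matrices\<close>

definition letter_val :: "('s \<Rightarrow> 'r::comm_ring_1 mat2) \<Rightarrow> 's \<times> bool \<Rightarrow> 'r mat2" where
  "letter_val Y l = (if snd l then Y (fst l) else adj (Y (fst l)))"

definition word_val :: "('s \<Rightarrow> 'r::comm_ring_1 mat2) \<Rightarrow> 's word \<Rightarrow> 'r mat2" where
  "word_val Y w = foldr (\<lambda>l. mat_mult (letter_val Y l)) w mat_one"

lemma word_val_Nil [simp]: "word_val Y [] = mat_one"
  and word_val_Cons [simp]: "word_val Y (l # w) = mat_mult (letter_val Y l) (word_val Y w)"
  by (simp_all add: word_val_def)

lemma word_val_gen [simp]: "word_val Y (gen s) = Y s"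
  by (simp add: gen_def letter_val_def)

lemma word_val_append: "word_val Y (u @ v) = mat_mult (word_val Y u) (word_val Y v)"
  by (induction u) (simp_all add: mat_mult_assoc)

lemma mat_det_letter_val [simp]: "mat_det (letter_val Y l) = mat_det (Y (fst l))"
  by (simp add: letter_val_def)

lemma letter_val_inv: "letter_val Y (inv_letter l) = adj (letter_val Y l)"
  by (simp add: letter_val_def inv_letter_def)

lemma word_val_cong: "(\<And>s. s \<in> fst ` set w \<Longrightarrow> Y s = Z s) \<Longrightarrow> word_val Y w = word_val Z w"
  by (induction w) (auto simp: letter_val_def)

text \<open>Products and adjugates are polynomial in the entries, so ring homomorphisms commute with
  evaluation. It is applied to substitutions and their iterates.\<close>

lemma word_val_map:
  assumes "\<And>x y. h (x + y) = h x + h y" "\<And>x y. h (x * y) = h x * h y" "h 1 = 1"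
  shows "map_mat2 h (word_val Y w) = word_val (\<lambda>s. map_mat2 h (Y s)) w"
proof -
  have h0: "h 0 = 0" using assms(1)[of 0 0] by simp
  have hm: "h (- x) = - h x" for x
    using assms(1)[of x "- x"] by (simp add: h0 eq_neg_iff_add_eq_0 add.commute)
  have "map_mat2 h (mat_mult A B) = mat_mult (map_mat2 h A) (map_mat2 h B)" for A B
    by (cases A; cases B) (simp add: mat_mult_def assms)
  moreover have "map_mat2 h (letter_val Y l) = letter_val (\<lambda>s. map_mat2 h (Y s)) l" for l
    by (cases "Y (fst l)") (simp add: letter_val_def adj_def hm)
  ultimately show ?thesis
    by (induction w) (simp_all add: mat_one_def h0 assms(3))
qed

context
  fixes J :: "'r::comm_ring_1 set" and S :: "'s set" and Y :: "'s \<Rightarrow> 'r mat2"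
  assumes J: "prime_ring_ideal J" and Y: "\<And>s. s \<in> S \<Longrightarrow> mat_det (Y s) \<notin> J"
begin

lemma mat_det_word_val: "fst ` set w \<subseteq> S \<Longrightarrow> mat_det (word_val Y w) \<notin> J"
  by (induction w)
     (auto simp: mat_det_mult_notin[OF J] Y mat_det_one_notin[OF J] simp del: mat_det_one)

text \<open>Cancelling a letter against its inverse changes the matrix by a determinant factor,
  which is invisible in the projective class.\<close>

lemma proj_class_cancel_cons:
  assumes "fst a \<in> S" "fst ` set w \<subseteq> S"
  shows "proj_class J (word_val Y (cancel_cons a w)) = proj_class J (word_val Y (a # w))"
proof (cases "w \<noteq> [] \<and> hd w = inv_letter a")
  case True
  then obtain v where v: "w = inv_letter a # v" by (cases w) auto
  have "word_val Y (a # w) = mat_scale (mat_det (letter_val Y a)) (word_val Y v)"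
    by (simp add: v letter_val_inv mat_mult_adj mat_scale_mult del: mat_det_letter_val
        flip: mat_mult_assoc)
  then show ?thesis
    using assms mat_det_word_val[of v] by (simp add: v proj_class_scale[OF J] Y)
next
  case False
  then show ?thesis by (cases w) auto
qed

lemma proj_class_reduce:
  "fst ` set w \<subseteq> S \<Longrightarrow> proj_class J (word_val Y (reduce w)) = proj_class J (word_val Y w)"
proof (induction w)
  case (Cons a w)
  have sub: "fst ` set (reduce w) \<subseteq> S"
    using image_mono[OF set_reduce[of w], of fst] Cons.prems by auto
  have a: "mat_det (letter_val Y a) \<notin> J" using Y Cons.prems by simp
  have "proj_class J (word_val Y (reduce (a # w)))
      = proj_class J (letter_val Y a) \<otimes>\<^bsub>proj_linear_group J\<^esub> proj_class J (word_val Y (reduce w))"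
    using proj_class_cancel_cons[of a "reduce w"] Cons.prems sub a mat_det_word_val[OF sub]
    by (simp add: proj_class_mult[OF J])
  also have "\<dots> = proj_class J (word_val Y (a # w))"
    using Cons a mat_det_word_val[of w] by (simp add: proj_class_mult[OF J])
  finally show ?case .
qed simp

lemma proj_class_word_val_hom:
  "(\<lambda>w. proj_class J (word_val Y w)) \<in> hom (free_group S) (proj_linear_group J)"
  by (rule homI)
     (simp_all add: proj_class_in_carrier[OF J] mat_det_word_val proj_class_reduce image_Un
        word_val_append proj_class_mult[OF J])

end

text \<open>The matrices are singular, of the form \<open>v v\<^sup>T\<close> with pairwise independent vectors \<open>v\<close>, so
  that products along reduced words can be read off from the scalar products of the vectors.\<close>

lemma word_val_rank_one:
  fixes e :: "'s \<Rightarrow> 'r::idom"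
  assumes nz: "\<And>s. s \<in> S \<Longrightarrow> e s \<noteq> 0" and inj: "inj_on e S"
    and orth: "\<And>s t. s \<in> S \<Longrightarrow> t \<in> S \<Longrightarrow> 1 + e s * e t \<noteq> 0"
    and w: "reduced w" "w \<noteq> []" "fst ` set w \<subseteq> S"
  shows "m12 (word_val (\<lambda>s. Mat 1 (e s) (e s) (e s ^ 2)) w) \<noteq> 0"
proof -
  define P where "P s = Mat 1 (e s) (e s) (e s ^ 2)" for s
  \<comment> \<open>The rank one matrix of a letter comes from the vector
    \<open>(p1 l, p2 l)\<close>: it is \<open>(1, e)\<close> for a generator, and the adjugate turns
    it into the orthogonal \<open>(e, -1)\<close>.\<close>
  define p1 where "p1 l = (if snd l then 1 else e (fst l))" for l :: "'s \<times> bool"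
  define p2 where "p2 l = (if snd l then e (fst l) else - 1)" for l :: "'s \<times> bool"
  have lv: "letter_val P l = Mat (p1 l * p1 l) (p1 l * p2 l) (p2 l * p1 l) (p2 l * p2 l)" for l
    by (simp add: letter_val_def P_def p1_def p2_def adj_def power2_eq_square)
  have "\<exists>q1 q2. q2 \<noteq> 0 \<and> word_val P w =
      Mat (p1 (hd w) * q1) (p1 (hd w) * q2) (p2 (hd w) * q1) (p2 (hd w) * q2)"
    using w
  proof (induction w)
    case (Cons l w)
    show ?case
    proof (cases w)
      case Nil
      then show ?thesis using Cons.prems nz[of "fst l"]
        by (intro exI[of _ "p1 l"] exI[of _ "p2 l"]) (auto simp: lv p2_def)
    next
      case (Cons l' w')
      obtain q1 q2 where q: "q2 \<noteq> 0" "word_val P w =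
          Mat (p1 l' * q1) (p1 l' * q2) (p2 l' * q1) (p2 l' * q2)"
        using Cons Cons.IH Cons.prems by (auto simp: reduced_Cons)
      define c where "c = p1 l * p1 l' + p2 l * p2 l'"
      have ll: "fst l \<in> S" "fst l' \<in> S" "l' \<noteq> inv_letter l"
        using Cons Cons.prems by (auto simp: reduced_Cons)
      have ne: "fst l \<noteq> fst l'" if "snd l \<noteq> snd l'"
        using ll(3) that by (auto simp: inv_letter_def prod_eq_iff)
      \<comment> \<open>For letters of equal sign the scalar product is
        \<open>1 + e s * e t\<close>; for opposite signs it is a difference of two values of
        \<open>e\<close>, at distinct generators because the word is reduced.\<close>
      have "c \<noteq> 0"
        using orth[OF ll(1,2)] ne inj_onD[OF inj _ ll(1,2)] unfolding c_def p1_def p2_def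
        by (cases "snd l"; cases "snd l'") (auto simp: add.commute)
      moreover have "word_val P (l # w) = Mat (p1 l * (c * q1)) (p1 l * (c * q2)) (p2 l * (c * q1)) (p2 l * (c * q2))"
        by (simp add: q(2) lv mat_mult_def c_def algebra_simps)
      ultimately show ?thesis using q(1)
        by (intro exI[of _ "c * q1"] exI[of _ "c * q2"]) simp
    qed
  qed simp
  moreover have "p1 (hd w) \<noteq> 0"
    using w nz[of "fst (hd w)"] by (cases w) (auto simp: p1_def)
  ultimately show ?thesis unfolding P_def by force
qed

section \<open>Separating the iterates of an injective endomorphism\<close>

lemma hom_free_group_eqI:
  assumes "group G" "h \<in> hom (free_group S) G" "h' \<in> hom (free_group S) G"
    and "\<And>s. s \<in> S \<Longrightarrow> h (gen s) = h' (gen s)" "w \<in> carrier (free_group S)"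
  shows "h w = h' w"
proof -
  have "(\<lambda>s. h (gen s)) \<in> S \<rightarrow> carrier G"
    using hom_in_carrier[OF assms(2)] gen_closed[of _ S] by blast
  from free_group_universal[OF assms(1) this] show ?thesis
    using assms(2-5) by metis
qed

lemma funpow_hom:
  fixes h :: "'r::comm_ring_1 \<Rightarrow> 'r"
  assumes "\<And>x y. h (x + y) = h x + h y" "\<And>x y. h (x * y) = h x * h y" "h 1 = 1"
  shows "(h ^^ j) (x + y) = (h ^^ j) x + (h ^^ j) y" "(h ^^ j) (x * y) = (h ^^ j) x * (h ^^ j) y"
    "(h ^^ j) 1 = 1"
  by (induction j) (simp_all add: assms)

text \<open>Each base generator gets four variables of its own, all with index below
  \<open>4 * k + 4\<close>; the identity at \<open>Stable\<close> is a default value.\<close>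

definition generic_mat :: "torus_gen \<Rightarrow> mpoly2 mat2" where
  "generic_mat s = (case s of
     Base i \<Rightarrow> Mat (var (4 * i)) (var (4 * i + 1)) (var (4 * i + 2)) (var (4 * i + 3))
   | Stable \<Rightarrow> mat_one)"

definition entry :: "'r mat2 \<Rightarrow> nat \<Rightarrow> 'r" where
  "entry A r = [m11 A, m12 A, m21 A, m22 A] ! r"

lemma map_mat2_subst_generic:
  "map_mat2 (subst b) (generic_mat (Base i))
    = Mat (b (4 * i)) (b (4 * i + 1)) (b (4 * i + 2)) (b (4 * i + 3))"
  by (simp add: generic_mat_def)

lemma map_mat2_subst_word_val:
  "map_mat2 (subst b) (word_val Y w) = word_val (\<lambda>s. map_mat2 (subst b) (Y s)) w"
  by (rule word_val_map) (simp_all add: subst_add subst_mult)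

lemma map_mat2_funpow_subst_word_val:
  "map_mat2 (subst b ^^ j) (word_val Y w) = word_val (\<lambda>s. map_mat2 (subst b ^^ j) (Y s)) w"
  by (rule word_val_map) (intro funpow_hom; simp add: subst_add subst_mult)+

lemma var_power_eq_iff: "var i ^ p = var i ^ q \<longleftrightarrow> p = q"
proof
  assume "var i ^ p = var i ^ q"
  then have "single (single i p) (1::bit) = single (single i q) 1" by (simp add: var_power)
  then have "lookup (single (single i p) (1::bit)) (single i p) = lookup (single (single i q) 1) (single i p)"
    by simp
  then have "single i q = single i p" by (auto simp: lookup_single when_def split: if_splits)
  then have "lookup (single i q) i = lookup (single i p) i" by simp
  then show "p = q" by simp
qed simp

lemma div_mod_four:
  "Suc (4 * i) div 4 = i" "Suc (4 * i) mod 4 = 1"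
  "Suc (Suc (4 * i)) div 4 = i" "Suc (Suc (4 * i)) mod 4 = 2"
  by presburger+

text \<open>Specialising \<open>Base i\<close> to the rank one matrix of \<open>(1, x_0^i)\<close>
  leaves the entry nonzero, so it is nonzero generically.\<close>

lemma word_val_generic_nonscalar:
  assumes "reduced w" "w \<noteq> []" "fst ` set w \<subseteq> base_gens k"
  shows "m12 (word_val generic_mat w) \<noteq> 0"
proof
  assume *: "m12 (word_val generic_mat w) = 0"
  define e where "e s = (case s of Base i \<Rightarrow> var 0 ^ i | Stable \<Rightarrow> 0)" for s
  \<comment> \<open>The index \<open>v\<close> stands for entry \<open>v mod 4\<close> of generator
    \<open>v div 4\<close>; with \<open>i = v div 4\<close> the four exponents of \<open>x_0\<close>
    are \<open>0, i, i, 2i\<close>.\<close>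
  define b where "b v = var 0 ^ (v div 4 * [0, 1, 1, 2] ! (v mod 4))" for v
  have b: "b (4 * i) = 1" "b (4 * i + 1) = var 0 ^ i" "b (4 * i + 2) = var 0 ^ i"
    "b (4 * i + 3) = (var 0 ^ i) ^ 2" for i
    by (simp_all add: b_def div_mod_four flip: power_mult)
  have "map_mat2 (subst b) (word_val generic_mat w) = word_val (\<lambda>s. Mat 1 (e s) (e s) (e s ^ 2)) w"
    unfolding map_mat2_subst_word_val
  proof (rule word_val_cong)
    fix s assume "s \<in> fst ` set w"
    then obtain i where "s = Base i" using assms(3) by blast
    then show "map_mat2 (subst b) (generic_mat s) = Mat 1 (e s) (e s) (e s ^ 2)"
      unfolding \<open>s = Base i\<close> map_mat2_subst_generic b by (simp add: e_def)
  qed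
  moreover have "m12 (word_val (\<lambda>s. Mat 1 (e s) (e s) (e s ^ 2)) w) \<noteq> 0"
  proof (rule word_val_rank_one[OF _ _ _ assms])
    fix s t assume "s \<in> base_gens k" "t \<in> base_gens k"
    then obtain i j where ij: "s = Base i" "i \<noteq> 0" "t = Base j" by auto
    have "var 0 \<noteq> 0" using var_power_eq_iff[of 0 1 2] by auto
    then show "e s \<noteq> 0" by (simp add: e_def ij)
    show "1 + e s * e t \<noteq> 0"
    proof
      assume "1 + e s * e t = 0"
      \<comment> \<open>In characteristic 2 this reads \<open>1 = x_0^(i+j)\<close>, impossible
        since generators are numbered from 1.\<close>
      then have "- (1 :: mpoly2) = e s * e t" by (rule minus_unique)
      then have "var 0 ^ 0 = var 0 ^ (i + j)" by (simp add: e_def ij power_add)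
      then show False using ij(2) by (simp only: var_power_eq_iff)
    qed
  next
    show "inj_on e (base_gens k)" by (auto simp: e_def inj_on_def var_power_eq_iff)
  qed
  moreover have "m12 (map_mat2 (subst b) (word_val generic_mat w)) = 0"
    by (simp add: mat2.map_sel *)
  ultimately show False by simp
qed

text \<open>The identity matrix is a specialisation with determinant 1.\<close>

lemma mat_det_generic: "mat_det (generic_mat (Base i)) \<noteq> 0"
proof
  assume *: "mat_det (generic_mat (Base i)) = 0"
  define b :: "nat \<Rightarrow> mpoly2" where "b v = (if v mod 4 \<in> {0, 3} then 1 else 0)" for v
  have "b (4 * i) = 1" "b (4 * i + 1) = 0" "b (4 * i + 3) = 1" by (simp_all add: b_def)
  then have "subst b (mat_det (generic_mat (Base i))) = 1"
    by (simp add: generic_mat_def mat_det_def subst_diff subst_mult)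
  then show False using * by simp
qed

lemma word_val_generic_in_vars:
  assumes "fst ` set w \<subseteq> base_gens k" "n = 4 * k + 4"
  shows "in_vars n (m11 (word_val generic_mat w)) \<and> in_vars n (m12 (word_val generic_mat w))
    \<and> in_vars n (m21 (word_val generic_mat w)) \<and> in_vars n (m22 (word_val generic_mat w))"
  using assms(1)
proof (induction w)
  case (Cons l w)
  then obtain i where i: "fst l = Base i" "i \<le> k" by auto
  have "in_vars n (m11 (letter_val generic_mat l)) \<and> in_vars n (m12 (letter_val generic_mat l))
      \<and> in_vars n (m21 (letter_val generic_mat l)) \<and> in_vars n (m22 (letter_val generic_mat l))"
    using i(2) assms(2)
    by (cases "snd l") (simp_all add: letter_val_def i(1) adj_def generic_mat_def in_vars_var)
  then show ?case
    using Cons by (simp add: mat_mult_def in_vars_add in_vars_mult)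
qed (simp add: mat_one_def)

text \<open>\<open>f j\<close> evaluates words at the \<open>j\<close>-th iterate of the generic
  matrices. Agreement on generators makes \<open>f (Suc j)\<close> equal to \<open>f j\<close> after
  \<open>\<phi>\<close>, so \<open>f j w\<close> is the value of \<open>f 0\<close> at the
  \<open>j\<close>-th iterate of \<open>w\<close>.\<close>

theorem exists_finite_group_separating_iterates:
  fixes k :: nat and \<phi> :: "torus_gen word \<Rightarrow> torus_gen word"
  defines "F \<equiv> free_group (base_gens k)"
  assumes \<phi>: "\<phi> \<in> hom (F) (F)" "inj_on \<phi> (carrier (F))"
    and w: "w \<in> carrier (F)" "w \<noteq> []"
  obtains G :: "mpoly2 mat2 set monoid" and f where
    "group G" "finite (carrier G)" "\<And>j. f j \<in> hom (F) G"
    "\<And>j i. i \<in> {1..k} \<Longrightarrow> f j (\<phi> (gen (Base i))) = f (Suc j) (gen (Base i))"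
    "\<And>j. f j w \<noteq> \<one>\<^bsub>G\<^esub>"
proof -
  define n where "n = 4 * k + 4"
  \<comment> \<open>The polynomial map: the variables of generator \<open>i\<close> go to the
    entries of the value of \<open>\<phi> x_i\<close>. Other indices get 0, as
    \<open>exists_finite_quasi_fixed_prime\<close> demands from \<open>n\<close> on.\<close>
  define a where "a v = (if v div 4 \<in> {1..k}
    then entry (word_val generic_mat (\<phi> (gen (Base (v div 4))))) (v mod 4) else 0)" for v
  define Y where "Y j s = map_mat2 (subst a ^^ j) (generic_mat s)" for j s
  interpret F: group "F" unfolding F_def by (rule group_free_group)
  have \<phi>_closed: "\<phi> u \<in> carrier (F)" if "u \<in> carrier (F)" for u
    using that hom_in_carrier[OF \<phi>(1)] by blast
  have letters: "fst ` set u \<subseteq> base_gens k" if "u \<in> carrier (F)" for u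
    using that by (simp add: F_def)
  have gen: "gen (Base i) \<in> carrier (F)" if "i \<in> {1..k}" for i
    unfolding F_def using that by (intro gen_closed) blast
  have Y_0: "Y 0 = generic_mat" by (rule ext) (simp add: Y_def mat2.map_ident_strong)
  have Y_word: "word_val (Y j) u = map_mat2 (subst a ^^ j) (word_val generic_mat u)" for j u
    unfolding Y_def map_mat2_funpow_subst_word_val ..
  have Y_Suc: "Y (Suc j) (Base i) = word_val (Y j) (\<phi> (gen (Base i)))" if "i \<in> {1..k}" for i j
  proof -
    let ?W = "word_val generic_mat (\<phi> (gen (Base i)))"
    have "a (4 * i) = m11 ?W" "a (4 * i + 1) = m12 ?W" "a (4 * i + 2) = m21 ?W" "a (4 * i + 3) = m22 ?W"
      using that by (simp_all add: a_def entry_def div_mod_four)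
    then have "map_mat2 (subst a) (generic_mat (Base i)) = ?W"
      by (simp add: map_mat2_subst_generic)
    moreover have "Y (Suc j) (Base i)
        = map_mat2 (subst a ^^ j) (map_mat2 (subst a) (generic_mat (Base i)))"
      by (simp only: Y_def mat2.map_comp funpow_Suc_right)
    ultimately show ?thesis by (simp add: Y_word)
  qed
  have entry_in_vars: "in_vars n (entry (word_val generic_mat u) r)"
    if "u \<in> carrier (F)" "r < 4" for u r
  proof -
    have "r = 0 \<or> r = 1 \<or> r = 2 \<or> r = 3" using that(2) by linarith
    then show ?thesis
      using word_val_generic_in_vars[OF letters[OF that(1)] n_def] by (auto simp: entry_def)
  qed
  have det_Y_zero: "mat_det (Y j s) \<notin> {0}" if "s \<in> base_gens k" for j s
    using that
  proof (induction j arbitrary: s)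
    case 0
    then show ?case using mat_det_generic by (auto simp: Y_0)
  next
    case (Suc j)
    then obtain i where i: "s = Base i" "i \<in> {1..k}" by blast
    have "mat_det (word_val (Y j) (\<phi> (gen (Base i)))) \<notin> {0}"
      using mat_det_word_val[OF prime_ring_ideal_zero Suc.IH letters[OF \<phi>_closed[OF gen[OF i(2)]]]] .
    then show ?case unfolding i(1) Y_Suc[OF i(2)] .
  qed
  define f where "f J j u = proj_class J (word_val (Y j) u)" for J j u
  have f_hom: "f J j \<in> hom (F) (proj_linear_group J)"
    if "prime_ring_ideal J" "\<And>s. s \<in> base_gens k \<Longrightarrow> mat_det (Y j s) \<notin> J" for J j
    using proj_class_word_val_hom[OF that] unfolding F_def f_def .
  have f_gen: "f J j (\<phi> (gen (Base i))) = f J (Suc j) (gen (Base i))" if "i \<in> {1..k}" for J j i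
    using Y_Suc[OF that] by (simp add: f_def)
  text \<open>The values of \<open>w\<close> at \<open>\<Phi>\<^sup>n(X)\<close> and of \<open>\<phi>\<^sup>n(w)\<close> at \<open>X\<close> agree up to nonzero scalars; they are compared
    in the projective linear group modulo the prime ideal \<open>{0}\<close>.\<close>
  have nonscalar: "\<not> scalar_mod {0} (word_val (Y n) w)"
  proof -
    let ?G = "proj_linear_group ({0} :: mpoly2 set)"
    note hom0 = f_hom[OF prime_ring_ideal_zero det_Y_zero]
    note group0 = group_proj_linear_group[OF prime_ring_ideal_zero]
    have step: "f {0} (Suc j) u = f {0} j (\<phi> u)" if "u \<in> carrier F" for u j
    proof -
      have "f {0} j \<circ> \<phi> \<in> hom F ?G" using hom_compose[OF \<phi>(1) hom0] .
      moreover have "(f {0} j \<circ> \<phi>) (gen s) = f {0} (Suc j) (gen s)" if s: "s \<in> base_gens k" for s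
      proof -
        obtain i where "s = Base i" "i \<in> {1..k}" using s by blast
        then show ?thesis using f_gen by (simp only: comp_apply)
      qed
      ultimately have "(f {0} j \<circ> \<phi>) u = f {0} (Suc j) u"
        using hom_free_group_eqI[OF group0 _ hom0[unfolded F_def]] that unfolding F_def by blast
      then show ?thesis by simp
    qed
    have iterate: "f {0} j u = f {0} 0 ((\<phi> ^^ j) u)" if "u \<in> carrier F" for j u
      using that
    proof (induction j arbitrary: u)
      case (Suc j)
      show ?case using Suc.IH[OF \<phi>_closed[OF Suc.prems]] step[OF Suc.prems]
        by (simp only: funpow_Suc_right comp_apply)
    qed simp
    have "\<phi> [] = []" using hom_one[OF \<phi>(1) F.is_group F.is_group] by (simp add: F_def)
    moreover have "[] \<in> carrier F" by (simp add: F_def)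
    \<comment> \<open>Injectivity enters here: no iterate of \<open>w\<close> becomes
      trivial.\<close>
    ultimately have \<phi>_neq: "\<phi> u \<noteq> []" if "u \<in> carrier F" "u \<noteq> []" for u
      using inj_onD[OF \<phi>(2), of u "[]"] that by metis
    have iter_w: "(\<phi> ^^ j) w \<in> carrier F \<and> (\<phi> ^^ j) w \<noteq> []" for j
    proof (induction j)
      case (Suc j)
      then show ?case using \<phi>_closed[of "(\<phi> ^^ j) w"] \<phi>_neq[of "(\<phi> ^^ j) w"] by simp
    qed (use w in simp)
    have "m12 (word_val (Y 0) ((\<phi> ^^ n) w)) \<noteq> 0"
      unfolding Y_0 using iter_w[of n] letters[of "(\<phi> ^^ n) w"]
      by (intro word_val_generic_nonscalar[where k = k]) (simp_all add: F_def)
    then have "\<not> scalar_mod {0} (word_val (Y 0) ((\<phi> ^^ n) w))" by (simp add: scalar_mod_def)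
    moreover have det: "mat_det (word_val (Y j) u) \<notin> {0}" if "u \<in> carrier F" for j u
      by (rule mat_det_word_val[OF prime_ring_ideal_zero det_Y_zero letters[OF that]])
    ultimately have "f {0} 0 ((\<phi> ^^ n) w) \<noteq> \<one>\<^bsub>?G\<^esub>"
      unfolding f_def using proj_class_eq_one_iff[OF prime_ring_ideal_zero det] iter_w by blast
    then have "f {0} n w \<noteq> \<one>\<^bsub>?G\<^esub>" using iterate[OF w(1)] by simp
    then show ?thesis
      unfolding f_def using proj_class_eq_one_iff[OF prime_ring_ideal_zero det[OF w(1)]] by blast
  qed
  define W where "W = word_val generic_mat w"
  have sh: "(subst a ^^ j) (x * y) = (subst a ^^ j) x * (subst a ^^ j) y"
    "(subst a ^^ j) (x - y) = (subst a ^^ j) x - (subst a ^^ j) y" for j x y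
    by (induction j) (simp_all add: subst_mult subst_diff)
  have sh_prod: "(subst a ^^ j) (\<Prod>i\<in>A. g i) = (\<Prod>i\<in>A. (subst a ^^ j) (g i))"
    for j and A :: "nat set" and g
    by (induction j) (simp_all add: subst_prod)
  have sh_det: "(subst a ^^ j) (mat_det A) = mat_det (map_mat2 (subst a ^^ j) A)" for j A
    by (cases A) (simp add: mat_det_def sh)
  \<comment> \<open>One of the three quantities that test for scalars survives \<open>n\<close>
    substitutions, because \<open>w\<close> is not scalar at \<open>Y n\<close>.\<close>
  obtain D where D: "D \<in> {m12 W, m21 W, m11 W - m22 W}" "(subst a ^^ n) D \<noteq> 0"
    using nonscalar unfolding Y_word W_def[symmetric] scalar_mod_def
    by (simp only: mat2.map_sel singleton_iff flip: sh(2)) blast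
  \<comment> \<open>Once the product avoids \<open>J\<close>, so do \<open>D\<close> and every
    determinant; stability extends this to all iterates.\<close>
  define E where "E = D * (\<Prod>i=1..k. mat_det (generic_mat (Base i)))"
  have "in_vars n D"
    using D(1) word_val_generic_in_vars[OF letters[OF w(1)] n_def]
    by (auto simp: W_def intro!: in_vars_diff)
  moreover have "in_vars n (\<Prod>i\<in>A. mat_det (generic_mat (Base i)))" if "finite A" "A \<subseteq> {1..k}" for A
    using that
  proof (induction A)
    case (insert i A)
    have "4 * i + 3 < n" using insert.prems by (simp add: n_def)
    then have "in_vars n (mat_det (generic_mat (Base i)))"
      unfolding mat_det_def generic_mat_def torus_gen.case mat2.sel
      by (intro in_vars_diff in_vars_mult) (simp_all add: in_vars_var)
    then show ?case using insert by (simp add: in_vars_mult)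
  qed simp
  ultimately have E_vars: "in_vars n E"
    unfolding E_def by (intro in_vars_mult) blast+
  have E_nz: "(subst a ^^ n) E \<noteq> 0"
  proof -
    have "(subst a ^^ n) (mat_det (generic_mat (Base i))) \<noteq> 0" if "i \<in> {1..k}" for i
      using det_Y_zero[of "Base i" n] that by (simp add: sh_det Y_def)
    then show ?thesis using D(2) by (simp add: E_def sh(1) sh_prod)
  qed
  have a_vars: "in_vars n (a v)" for v
    using entry_in_vars[OF \<phi>_closed[OF gen, of "v div 4"], of "v mod 4"]
    by (cases "v div 4 \<in> {1..k}") (simp_all add: a_def)
  have a_zero: "a v = 0" if "n \<le> v" for v
  proof -
    have "v div 4 \<notin> {1..k}" using that div_le_mono[of n v 4] by (simp add: n_def)
    then show ?thesis unfolding a_def by (rule if_not_P)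
  qed
  obtain J T where J: "prime_ring_ideal J" "finite T" "\<And>x. \<exists>t\<in>T. x - t \<in> J"
    and stable: "\<And>j x. x \<notin> J \<Longrightarrow> (subst a ^^ j) x \<notin> J" and EJ: "E \<notin> J"
    by (rule exists_finite_quasi_fixed_prime[where a = a and n = n and E = E])
       (use a_vars a_zero E_vars E_nz that in blast)+
  note J_mult = ring_idealD(3,4)[OF prime_ring_idealD(1)[OF J(1)]]
  have DJ: "D \<notin> J" using EJ J_mult(2)[of D] unfolding E_def by blast
  have det_J: "mat_det (generic_mat (Base i)) \<notin> J" if "i \<in> {1..k}" for i
  proof
    assume *: "mat_det (generic_mat (Base i)) \<in> J"
    have "E = D * (\<Prod>i\<in>{1..k} - {i}. mat_det (generic_mat (Base i))) * mat_det (generic_mat (Base i))"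
      unfolding E_def prod.remove[OF finite_atLeastAtMost that] by (simp only: mult_ac)
    then show False using EJ J_mult(1)[OF *] by metis
  qed
  have det_Y_J: "mat_det (Y j s) \<notin> J" if s: "s \<in> base_gens k" for j s
  proof -
    obtain i where i: "s = Base i" "i \<in> {1..k}" using s by blast
    show ?thesis using stable[OF det_J[OF i(2)], of j] unfolding Y_def sh_det i(1) .
  qed
  show ?thesis
  proof (rule that[of "proj_linear_group J" "f J"])
    show "f J j w \<noteq> \<one>\<^bsub>proj_linear_group J\<^esub>" for j
    proof -
      have "(subst a ^^ j) D \<notin> J" using stable[OF DJ] .
      then have "\<not> scalar_mod J (word_val (Y j) w)"
        using D(1) unfolding Y_word W_def[symmetric] scalar_mod_def
        by (simp only: mat2.map_sel flip: sh(2)) blast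
      moreover have "mat_det (word_val (Y j) w) \<notin> J"
        by (rule mat_det_word_val[OF J(1) det_Y_J letters[OF w(1)]])
      ultimately show ?thesis
        unfolding f_def using proj_class_eq_one_iff[OF J(1)] by blast
    qed
    show "group (proj_linear_group J)" by (rule group_proj_linear_group[OF J(1)])
    show "finite (carrier (proj_linear_group J))" by (rule finite_proj_linear_group[OF J])
    show "f J j \<in> hom F (proj_linear_group J)" for j by (rule f_hom[OF J(1) det_Y_J])
  qed (rule f_gen)
qed

section \<open>Mapping tori\<close>

declare One_nat_def [simp del] free_group_simps [simp del]

text \<open>The quotient by the kernel of \<open>h\<close> embeds in the finite group
  \<open>B\<close>.\<close>

lemma finite_index_kernel:
  assumes "group G" "group B" "finite (carrier B)" "h \<in> hom G B" "x \<in> carrier G" "h x \<noteq> \<one>\<^bsub>B\<^esub>"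
  shows "\<exists>K. subgroup K G \<and> finite (rcosets\<^bsub>G\<^esub> K) \<and> x \<notin> K"
proof -
  interpret h: group_hom G B h using assms by (simp add: group_hom_def group_hom_axioms_def)
  have "(\<lambda>C. the_elem (h ` C)) ` carrier (G Mod kernel G B h) \<subseteq> carrier B"
    using h.FactGroup_the_elem_mem by blast
  then have "finite (carrier (G Mod kernel G B h))"
    using inj_on_finite[OF h.FactGroup_inj_on] assms(3) by blast
  then have "finite (rcosets\<^bsub>G\<^esub> (kernel G B h))" by (simp add: FactGroup_def)
  moreover have "x \<notin> kernel G B h" using assms(6) by (simp add: kernel_def)
  ultimately show ?thesis using h.subgroup_kernel by blast
qed

lemma residually_finiteI:
  assumes "group G"
    and "\<And>x. x \<in> carrier G \<Longrightarrow> x \<noteq> \<one>\<^bsub>G\<^esub> \<Longrightarrow> \<exists>K. subgroup K G \<and> finite (rcosets\<^bsub>G\<^esub> K) \<and> x \<notin> K"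
  shows "residually_finite G"
proof -
  interpret group G by fact
  have "finite (rcosets\<^bsub>G\<^esub> (carrier G))" using coset_join2[OF _ subgroup_self] by (auto simp: RCOSETS_def)
  then have "x \<in> carrier G" if "x \<in> \<Inter>{H. subgroup H G \<and> finite (rcosets\<^bsub>G\<^esub> H)}" for x
    using that subgroup_self by blast
  then show ?thesis
    unfolding residually_finite_def using assms subgroup.one_closed by blast
qed

section \<open>Permutations of finite sets\<close>

lemma finite_BijGroup: "finite A \<Longrightarrow> finite (carrier (BijGroup A))"
  by (rule finite_subset[OF _ finite_PiE[of A "\<lambda>_. A"]])
     (auto simp: BijGroup_def Bij_def bij_betw_def PiE_def)

lemma finite_inj_in_Bij:
  assumes "finite A" "g ` A \<subseteq> A" "inj_on g A"
  shows "restrict g A \<in> Bij A"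
proof -
  have "g ` A = A" using endo_inj_surj[OF assms] .
  then show ?thesis using assms(3) by (simp add: Bij_def bij_betw_def)
qed

section \<open>Relations and normal forms in the mapping torus\<close>

locale torus =
  fixes k :: nat and \<phi> :: "torus_gen word \<Rightarrow> torus_gen word"
  assumes hom_\<phi>: "\<phi> \<in> hom (free_group (base_gens k)) (free_group (base_gens k))"
begin

abbreviation "gens \<equiv> insert Stable (base_gens k)"
abbreviation "FB \<equiv> free_group (base_gens k)"
abbreviation "FS \<equiv> free_group gens"
abbreviation "M \<equiv> mapping_torus k \<phi>"

definition relator :: "nat \<Rightarrow> torus_gen word" where
  "relator i = gen Stable \<otimes>\<^bsub>FS\<^esub> gen (Base i) \<otimes>\<^bsub>FS\<^esub> inv\<^bsub>FS\<^esub> gen Stable \<otimes>\<^bsub>FS\<^esub> inv\<^bsub>FS\<^esub> \<phi> (gen (Base i))"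

abbreviation "N \<equiv> normal_closure FS (relator ` {1..k})"

sublocale FS: group FS by (rule group_free_group)
sublocale FB: group FB by (rule group_free_group)
sublocale M: group M by (rule group_mapping_torus[OF hom_\<phi>])

lemma M_eq: "M = FS Mod N"
  unfolding mapping_torus_def presented_group_def Let_def relator_def
  by (rule arg_cong[of _ _ "\<lambda>R. FS Mod normal_closure FS R"]) auto

lemma FB_subset_FS: "u \<in> carrier FB \<Longrightarrow> u \<in> carrier FS"
  by (auto simp: free_group_simps)

lemma \<phi>_closed: "u \<in> carrier FB \<Longrightarrow> \<phi> u \<in> carrier FB"
  using hom_in_carrier[OF hom_\<phi>] .

lemma gen_Base: "i \<in> {1..k} \<Longrightarrow> gen (Base i) \<in> carrier FB"
  by (rule gen_closed) blast

lemma gen_Stable: "gen Stable \<in> carrier FS"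
  by (rule gen_closed) blast

lemma hom_restrict: "h \<in> hom FS G \<Longrightarrow> h \<in> hom FB G"
proof (rule homI)
  fix u v assume h: "h \<in> hom FS G" and uv: "u \<in> carrier FB" "v \<in> carrier FB"
  have "u \<otimes>\<^bsub>FB\<^esub> v = u \<otimes>\<^bsub>FS\<^esub> v" by (simp add: free_group_simps)
  then show "h (u \<otimes>\<^bsub>FB\<^esub> v) = h u \<otimes>\<^bsub>G\<^esub> h v"
    using hom_mult[OF h FB_subset_FS[OF uv(1)] FB_subset_FS[OF uv(2)]] by simp
qed (rule hom_in_carrier[OF _ FB_subset_FS])

lemma relator_closed: "relator i \<in> carrier FS" if "i \<in> {1..k}"
  unfolding relator_def using gen_Stable FB_subset_FS[OF gen_Base[OF that]]
    FB_subset_FS[OF \<phi>_closed[OF gen_Base[OF that]]]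
  by (intro FS.m_closed FS.inv_closed)

sublocale N: normal N FS
  by (rule FS.normal_closure_normal) (use relator_closed in blast)

definition proj :: "torus_gen word \<Rightarrow> torus_gen word set" where
  "proj u = N #>\<^bsub>FS\<^esub> u"

lemma proj_hom: "proj \<in> hom FS M"
  unfolding M_eq proj_def by (rule N.r_coset_hom_Mod)

sublocale proj: group_hom FS M proj
  by unfold_locales (rule proj_hom)

lemma proj_surj:
  assumes "x \<in> carrier M"
  obtains u where "u \<in> carrier FS" "x = proj u"
  using assms unfolding M_eq FactGroup_def RCOSETS_def proj_def by auto

abbreviation "T \<equiv> proj (gen Stable)"

lemma T_closed [simp]: "T \<in> carrier M"
  using gen_Stable by (rule proj.hom_closed)

lemma inv_T_cancel [simp]:
  "y \<in> carrier M \<Longrightarrow> inv\<^bsub>M\<^esub> T \<otimes>\<^bsub>M\<^esub> (T \<otimes>\<^bsub>M\<^esub> y) = y"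
  "y \<in> carrier M \<Longrightarrow> T \<otimes>\<^bsub>M\<^esub> (inv\<^bsub>M\<^esub> T \<otimes>\<^bsub>M\<^esub> y) = y"
  by (simp_all flip: M.m_assoc)

lemma proj_closed: "u \<in> carrier FB \<Longrightarrow> proj u \<in> carrier M"
  using FB_subset_FS by (rule proj.hom_closed)

lemma proj_relator: "i \<in> {1..k} \<Longrightarrow> proj (relator i) = \<one>\<^bsub>M\<^esub>"
proof -
  assume i: "i \<in> {1..k}"
  have "relator i = \<one>\<^bsub>FS\<^esub> \<otimes>\<^bsub>FS\<^esub> relator i \<otimes>\<^bsub>FS\<^esub> inv\<^bsub>FS\<^esub> \<one>\<^bsub>FS\<^esub>"
    using relator_closed[OF i] FS.inv_one FS.l_one FS.r_one by metis
  then have "relator i \<in> N"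
    unfolding normal_closure_def using i by (intro generate.incl) blast
  then have "N #>\<^bsub>FS\<^esub> relator i = N"
    using FS.coset_join2[OF relator_closed[OF i] N.subgroup_axioms] by blast
  then show ?thesis by (simp add: proj_def M_eq FactGroup_def)
qed

lemma stable_conj_gen:
  assumes "i \<in> {1..k}"
  shows "T \<otimes>\<^bsub>M\<^esub> proj (gen (Base i)) \<otimes>\<^bsub>M\<^esub> inv\<^bsub>M\<^esub> T = proj (\<phi> (gen (Base i)))"
proof -
  note c = gen_Stable FB_subset_FS[OF gen_Base[OF assms]] FB_subset_FS[OF \<phi>_closed[OF gen_Base[OF assms]]]
  have "\<one>\<^bsub>M\<^esub> = proj (relator i)" using proj_relator[OF assms] by simp
  also have "\<dots> = (T \<otimes>\<^bsub>M\<^esub> proj (gen (Base i)) \<otimes>\<^bsub>M\<^esub> inv\<^bsub>M\<^esub> T) \<otimes>\<^bsub>M\<^esub> inv\<^bsub>M\<^esub> proj (\<phi> (gen (Base i)))"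
    unfolding relator_def
    using c by (simp only: proj.hom_mult proj.hom_inv FS.m_closed FS.inv_closed)
  finally show ?thesis
    using c[THEN proj.hom_closed]
      M.inv_solve_right[of "\<one>\<^bsub>M\<^esub>" "T \<otimes>\<^bsub>M\<^esub> proj (gen (Base i)) \<otimes>\<^bsub>M\<^esub> inv\<^bsub>M\<^esub> T" "proj (\<phi> (gen (Base i)))"]
    by simp
qed

text \<open>Conjugation by \<open>T\<close> and the map \<open>\<phi>\<close> induce two
  homomorphisms from the base group to the torus, which agree on generators by the relators.\<close>

lemma stable_conj:
  assumes "v \<in> carrier FB"
  shows "T \<otimes>\<^bsub>M\<^esub> proj v = proj (\<phi> v) \<otimes>\<^bsub>M\<^esub> T"
proof -
  have 1: "(\<lambda>v. T \<otimes>\<^bsub>M\<^esub> proj v \<otimes>\<^bsub>M\<^esub> inv\<^bsub>M\<^esub> T) \<in> hom FB M"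
  proof (rule homI)
    fix u v assume *: "u \<in> carrier FB" "v \<in> carrier FB"
    have "proj (u \<otimes>\<^bsub>FB\<^esub> v) = proj u \<otimes>\<^bsub>M\<^esub> proj v"
      using hom_mult[OF hom_restrict[OF proj_hom] *] .
    then show "T \<otimes>\<^bsub>M\<^esub> proj (u \<otimes>\<^bsub>FB\<^esub> v) \<otimes>\<^bsub>M\<^esub> inv\<^bsub>M\<^esub> T
        = T \<otimes>\<^bsub>M\<^esub> proj u \<otimes>\<^bsub>M\<^esub> inv\<^bsub>M\<^esub> T \<otimes>\<^bsub>M\<^esub> (T \<otimes>\<^bsub>M\<^esub> proj v \<otimes>\<^bsub>M\<^esub> inv\<^bsub>M\<^esub> T)"
      using proj_closed[OF *(1)] proj_closed[OF *(2)]
      by (simp add: M.m_assoc)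
  qed (use proj_closed in \<open>simp\<close>)
  have 2: "(\<lambda>v. proj (\<phi> v)) \<in> hom FB M"
    using hom_compose[OF hom_\<phi> hom_restrict[OF proj_hom]] by (simp add: comp_def)
  have "T \<otimes>\<^bsub>M\<^esub> proj v \<otimes>\<^bsub>M\<^esub> inv\<^bsub>M\<^esub> T = proj (\<phi> v)"
    using hom_free_group_eqI[OF M.group_axioms 1 2 _ assms] stable_conj_gen by blast
  then show ?thesis
    using proj_closed[OF assms] proj_closed[OF \<phi>_closed[OF assms]]
    by (metis M.inv_solve_right M.m_closed T_closed)
qed

lemma funpow_\<phi>_closed: "v \<in> carrier FB \<Longrightarrow> (\<phi> ^^ a) v \<in> carrier FB"
  by (induction a) (simp_all add: \<phi>_closed)

lemma stable_pow_conj: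
  assumes "v \<in> carrier FB"
  shows "T [^]\<^bsub>M\<^esub> a \<otimes>\<^bsub>M\<^esub> proj v = proj ((\<phi> ^^ a) v) \<otimes>\<^bsub>M\<^esub> T [^]\<^bsub>M\<^esub> (a :: nat)"
proof (induction a)
  case 0
  then show ?case using proj_closed[OF assms] by simp
next
  case (Suc a)
  note c = proj_closed[OF assms] proj_closed[OF funpow_\<phi>_closed[OF assms, of a]]
    proj_closed[OF \<phi>_closed[OF funpow_\<phi>_closed[OF assms, of a]]]
  have "T [^]\<^bsub>M\<^esub> Suc a \<otimes>\<^bsub>M\<^esub> proj v = T \<otimes>\<^bsub>M\<^esub> (T [^]\<^bsub>M\<^esub> a \<otimes>\<^bsub>M\<^esub> proj v)"
    unfolding M.nat_pow_Suc2[OF T_closed] using c by (simp add: M.m_assoc)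
  also have "\<dots> = (T \<otimes>\<^bsub>M\<^esub> proj ((\<phi> ^^ a) v)) \<otimes>\<^bsub>M\<^esub> T [^]\<^bsub>M\<^esub> a"
    using c by (simp add: Suc M.m_assoc)
  also have "\<dots> = proj (\<phi> ((\<phi> ^^ a) v)) \<otimes>\<^bsub>M\<^esub> (T \<otimes>\<^bsub>M\<^esub> T [^]\<^bsub>M\<^esub> a)"
    using c by (simp add: stable_conj[OF funpow_\<phi>_closed[OF assms]] M.m_assoc)
  also have "T \<otimes>\<^bsub>M\<^esub> T [^]\<^bsub>M\<^esub> a = T [^]\<^bsub>M\<^esub> Suc a"
    unfolding M.nat_pow_Suc2[OF T_closed] ..
  finally show ?case by simp
qed

text \<open>Positive powers of \<open>T\<close> move right past base words at the cost of applying
  \<open>\<phi>\<close>. Inverse stable letters cannot, as \<open>\<phi>\<close> may fail to be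
  onto; each is absorbed by raising \<open>a\<close>.\<close>

lemma normal_form:
  assumes "u \<in> carrier FS"
  shows "\<exists>a b v. v \<in> carrier FB \<and> T [^]\<^bsub>M\<^esub> (a::nat) \<otimes>\<^bsub>M\<^esub> proj u = proj v \<otimes>\<^bsub>M\<^esub> T [^]\<^bsub>M\<^esub> (b::nat)"
  using assms
proof (induction u)
  case Nil
  have "proj [] = \<one>\<^bsub>M\<^esub>" using proj.hom_one by (simp add: free_group_simps)
  then show ?case by (intro exI[of _ 0] exI[of _ "[]"]) (simp add: free_group_simps)
next
  case (Cons l u)
  then have u: "u \<in> carrier FS" and l: "[l] \<in> carrier FS" by (auto simp: reduced_Cons free_group_simps)
  have "l # u = [l] \<otimes>\<^bsub>FS\<^esub> u" using reduce_reduced[of "l # u"] Cons.prems by (simp add: free_group_simps)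
  then have lu: "proj (l # u) = proj [l] \<otimes>\<^bsub>M\<^esub> proj u" using proj.hom_mult[OF l u] by (simp only:)
  note cl = proj.hom_closed[OF l] and cu = proj.hom_closed[OF u]
  from Cons.IH[OF u] obtain a b :: nat and v where v: "v \<in> carrier FB"
    and IH: "T [^]\<^bsub>M\<^esub> a \<otimes>\<^bsub>M\<^esub> proj u = proj v \<otimes>\<^bsub>M\<^esub> T [^]\<^bsub>M\<^esub> b" by blast
  note cv = proj_closed[OF v] proj_closed[OF \<phi>_closed[OF v]]
  consider "[l] \<in> carrier FB" | "l = (Stable, True)" | "l = (Stable, False)"
    using l by (cases l; cases "snd l") (auto simp: free_group_simps)
  then show ?case
  proof cases
    case 1
    let ?x = "(\<phi> ^^ a) [l]"
    have x: "?x \<in> carrier FB" by (rule funpow_\<phi>_closed[OF 1])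
    have "T [^]\<^bsub>M\<^esub> a \<otimes>\<^bsub>M\<^esub> proj (l # u) = T [^]\<^bsub>M\<^esub> a \<otimes>\<^bsub>M\<^esub> proj [l] \<otimes>\<^bsub>M\<^esub> proj u"
      using cl cu by (simp add: lu M.m_assoc)
    also have "\<dots> = proj ?x \<otimes>\<^bsub>M\<^esub> (T [^]\<^bsub>M\<^esub> a \<otimes>\<^bsub>M\<^esub> proj u)"
      using proj_closed[OF x] cu by (simp add: stable_pow_conj[OF 1] M.m_assoc)
    also have "\<dots> = proj ?x \<otimes>\<^bsub>M\<^esub> proj v \<otimes>\<^bsub>M\<^esub> T [^]\<^bsub>M\<^esub> b"
      using proj_closed[OF x] cv by (simp add: IH M.m_assoc)
    also have "proj ?x \<otimes>\<^bsub>M\<^esub> proj v = proj (?x \<otimes>\<^bsub>FB\<^esub> v)"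
      using hom_mult[OF hom_restrict[OF proj_hom] x v] by simp
    finally show ?thesis using FB.m_closed[OF x v] by blast
  next
    case 2
    have "T [^]\<^bsub>M\<^esub> a \<otimes>\<^bsub>M\<^esub> proj (l # u) = T \<otimes>\<^bsub>M\<^esub> (T [^]\<^bsub>M\<^esub> a \<otimes>\<^bsub>M\<^esub> proj u)"
    proof -
      have "T [^]\<^bsub>M\<^esub> a \<otimes>\<^bsub>M\<^esub> T = T \<otimes>\<^bsub>M\<^esub> T [^]\<^bsub>M\<^esub> a"
        using M.nat_pow_Suc2[OF T_closed, of a] by simp
      moreover have "proj [l] = T" by (simp add: 2 gen_def)
      ultimately show ?thesis using cu by (simp add: lu flip: M.m_assoc)
    qed
    also have "\<dots> = proj (\<phi> v) \<otimes>\<^bsub>M\<^esub> (T \<otimes>\<^bsub>M\<^esub> T [^]\<^bsub>M\<^esub> b)"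
    proof -
      have "T \<otimes>\<^bsub>M\<^esub> (T [^]\<^bsub>M\<^esub> a \<otimes>\<^bsub>M\<^esub> proj u) = (T \<otimes>\<^bsub>M\<^esub> proj v) \<otimes>\<^bsub>M\<^esub> T [^]\<^bsub>M\<^esub> b"
        using cv by (simp add: IH M.m_assoc)
      then show ?thesis using cv by (simp add: stable_conj[OF v] M.m_assoc)
    qed
    also have "T \<otimes>\<^bsub>M\<^esub> T [^]\<^bsub>M\<^esub> b = T [^]\<^bsub>M\<^esub> Suc b"
      using M.nat_pow_Suc2[OF T_closed, of b] by simp
    finally show ?thesis using \<phi>_closed[OF v] by blast
  next
    case 3
    have "[l] = inv\<^bsub>FS\<^esub> gen Stable" using 3 inv_gen[of Stable gens] by simp
    then have "proj [l] = inv\<^bsub>M\<^esub> T" using proj.hom_inv[OF gen_Stable] by simp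
    then have "T [^]\<^bsub>M\<^esub> Suc a \<otimes>\<^bsub>M\<^esub> proj (l # u) = T [^]\<^bsub>M\<^esub> a \<otimes>\<^bsub>M\<^esub> (T \<otimes>\<^bsub>M\<^esub> inv\<^bsub>M\<^esub> T) \<otimes>\<^bsub>M\<^esub> proj u"
      using cu by (simp add: lu M.m_assoc del: M.r_inv)
    also have "\<dots> = proj v \<otimes>\<^bsub>M\<^esub> T [^]\<^bsub>M\<^esub> b" using cu by (simp add: IH)
    finally show ?thesis using v by blast
  qed
qed

section \<open>Finite permutation representations of the mapping torus\<close>

lemma hom_factor:
  assumes "group B" "h \<in> hom FS B" "\<And>i. i \<in> {1..k} \<Longrightarrow> h (relator i) = \<one>\<^bsub>B\<^esub>"
  obtains g where "g \<in> hom M B" "\<And>u. u \<in> carrier FS \<Longrightarrow> g (proj u) = h u"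
proof -
  interpret B: group B by fact
  interpret h: group_hom FS B h by unfold_locales (rule assms(2))
  have "N \<subseteq> kernel FS B h"
    unfolding normal_closure_def
  proof (rule FS.generate_subgroup_incl[OF _ h.subgroup_kernel], rule subsetI)
    fix y assume "y \<in> {g \<otimes>\<^bsub>FS\<^esub> r \<otimes>\<^bsub>FS\<^esub> inv\<^bsub>FS\<^esub> g |g r. g \<in> carrier FS \<and> r \<in> relator ` {1..k}}"
    then obtain g i where y: "y = g \<otimes>\<^bsub>FS\<^esub> relator i \<otimes>\<^bsub>FS\<^esub> inv\<^bsub>FS\<^esub> g" "g \<in> carrier FS" "i \<in> {1..k}"
      by blast
    then have "h y = \<one>\<^bsub>B\<^esub>"
      using relator_closed[OF y(3)] assms(3)[OF y(3)]
      by (simp only: y(1) h.hom_mult h.hom_inv FS.m_closed FS.inv_closed B.r_one h.hom_closed B.r_inv)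
    moreover have "y \<in> carrier FS"
      unfolding y(1) using y(2) relator_closed[OF y(3)] by (intro FS.m_closed FS.inv_closed)
    ultimately show "y \<in> kernel FS B h" by (simp add: kernel_def)
  qed
  then have ker: "h z = \<one>\<^bsub>B\<^esub>" if "z \<in> N" for z using that by (auto simp: kernel_def)
  have "h x = h y" if "x \<in> carrier FS" "y \<in> carrier FS" "N #>\<^bsub>FS\<^esub> x = N #>\<^bsub>FS\<^esub> y" for x y
  proof -
    have "x \<in> N #>\<^bsub>FS\<^esub> y" using FS.rcos_self[OF that(1) N.subgroup_axioms] that(3) by simp
    then obtain z where z: "z \<in> N" "x = z \<otimes>\<^bsub>FS\<^esub> y" by (auto simp: r_coset_def)
    then show ?thesis
      using ker[OF z(1)] h.hom_mult[OF N.mem_carrier[OF z(1)] that(2)] h.hom_closed[OF that(2)]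
      by (simp only: B.l_one)
  qed
  from FactGroup_universal[OF assms(2) N.normal_axioms this]
  obtain g where "g \<in> hom (FS Mod N) B" "\<And>x. x \<in> carrier FS \<Longrightarrow> g (N #>\<^bsub>FS\<^esub> x) = h x" by blast
  then show ?thesis using that unfolding M_eq proj_def by blast
qed

text \<open>The base group acts on layer \<open>j\<close> by left multiplication through
  \<open>f j\<close>, and \<open>T\<close> lowers the layer cyclically, written as adding
  \<open>m - 1\<close>. The relations hold because, cyclically, \<open>f (j - 1)\<close> after
  \<open>\<phi>\<close> is \<open>f j\<close> on generators.\<close>

lemma hom_to_permutations:
  fixes f :: "nat \<Rightarrow> torus_gen word \<Rightarrow> 'g"
  assumes G: "group G" "finite (carrier G)" and m: "0 < m"
    and f: "\<And>j. f j \<in> hom FB G"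
    and shift: "\<And>j i. j < m \<Longrightarrow> i \<in> {1..k} \<Longrightarrow> f j (\<phi> (gen (Base i))) = f (Suc j mod m) (gen (Base i))"
  defines "\<Omega> \<equiv> {..<m} \<times> carrier G"
  obtains g where "g \<in> hom M (BijGroup \<Omega>)"
    "\<And>v. v \<in> carrier FB \<Longrightarrow> g (proj v) = (\<lambda>(j, y)\<in>\<Omega>. (j, f j v \<otimes>\<^bsub>G\<^esub> y))"
    "g T = (\<lambda>(j, y)\<in>\<Omega>. ((j + (m - 1)) mod m, y))"
proof -
  interpret G: group G by fact
  let ?B = "BijGroup \<Omega>"
  interpret B: group ?B by (rule group_BijGroup)
  have fin: "finite \<Omega>" using G(2) by (simp add: \<Omega>_def)
  define \<psi> where "\<psi> v = (\<lambda>(j, y)\<in>\<Omega>. (j, f j v \<otimes>\<^bsub>G\<^esub> y))" for v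
  define \<tau> where "\<tau> = (\<lambda>(j, y)\<in>\<Omega>. ((j + (m - 1)) mod m, y))"
  have fc: "f j v \<in> carrier G" if "v \<in> carrier FB" for j v
    using that f hom_in_carrier by metis
  have \<psi>_Bij: "\<psi> v \<in> Bij \<Omega>" if "v \<in> carrier FB" for v
    unfolding \<psi>_def
    by (rule finite_inj_in_Bij[OF fin])
       (use fc[OF that] in \<open>auto simp: \<Omega>_def inj_on_def\<close>)
  have \<tau>_Bij: "\<tau> \<in> Bij \<Omega>"
    unfolding \<tau>_def
  proof (rule finite_inj_in_Bij[OF fin])
    have shift_inj: "j = j'" if "(j + (m - 1)) mod m = (j' + (m - 1)) mod m" "j < m" "j' < m" for j j'
    proof -
      have "(j + (m - 1) + 1) mod m = (j' + (m - 1) + 1) mod m" using mod_add_cong[OF that(1) refl] .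
      moreover have "j + (m - 1) + 1 = j + m" "j' + (m - 1) + 1 = j' + m" using m by simp_all
      ultimately show ?thesis using that by simp
    qed
    show "inj_on (\<lambda>(j, y). ((j + (m - 1)) mod m, y)) \<Omega>"
    proof (rule inj_onI)
      fix z z' assume z: "z \<in> \<Omega>" "z' \<in> \<Omega>"
        and eq: "(\<lambda>(j, y). ((j + (m - 1)) mod m, y)) z = (\<lambda>(j, y). ((j + (m - 1)) mod m, y)) z'"
      have "fst z = fst z'"
        using shift_inj[of "fst z" "fst z'"] z eq by (simp add: \<Omega>_def mem_Times_iff split_beta)
      then show "z = z'" using eq by (simp add: prod_eq_iff split_beta)
    qed
  qed (use m in \<open>auto simp: \<Omega>_def\<close>)
  have mult: "p \<otimes>\<^bsub>?B\<^esub> q = (\<lambda>z\<in>\<Omega>. p (q z))" if "p \<in> Bij \<Omega>" "q \<in> Bij \<Omega>" for p q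
    using that by (simp add: BijGroup_def compose_def)
  have B_carrier: "carrier ?B = Bij \<Omega>" by (simp add: BijGroup_def)
  have \<psi>_hom: "\<psi> \<in> hom FB ?B"
  proof (rule homI)
    fix u v assume uv: "u \<in> carrier FB" "v \<in> carrier FB"
    have "f j (u \<otimes>\<^bsub>FB\<^esub> v) = f j u \<otimes>\<^bsub>G\<^esub> f j v" for j using hom_mult[OF f uv] .
    then have "\<psi> (u \<otimes>\<^bsub>FB\<^esub> v) = (\<lambda>z\<in>\<Omega>. \<psi> u (\<psi> v z))"
      unfolding \<psi>_def using fc[OF uv(1)] fc[OF uv(2)]
      by (intro restrict_ext) (auto simp: \<Omega>_def G.m_assoc)
    then show "\<psi> (u \<otimes>\<^bsub>FB\<^esub> v) = \<psi> u \<otimes>\<^bsub>?B\<^esub> \<psi> v"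
      unfolding mult[OF \<psi>_Bij[OF uv(1)] \<psi>_Bij[OF uv(2)]] .
  qed (simp only: \<psi>_Bij B_carrier)
  define \<beta> where "\<beta> s = (if s = Stable then \<tau> else \<psi> (gen s))" for s
  have "\<beta> \<in> gens \<rightarrow> carrier ?B"
    using \<tau>_Bij \<psi>_Bij[OF gen_closed[of _ "base_gens k"]] by (auto simp: \<beta>_def B_carrier)
  from free_group_universal[OF B.group_axioms this]
  obtain h where h: "h \<in> hom FS ?B" "\<And>s. s \<in> gens \<Longrightarrow> h (gen s) = \<beta> s" by blast
  have h_FB: "h v = \<psi> v" if "v \<in> carrier FB" for v
    by (rule hom_free_group_eqI[OF B.group_axioms hom_restrict[OF h(1)] \<psi>_hom _ that])
       (use h(2) in \<open>auto simp: \<beta>_def\<close>)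
  have h_T: "h (gen Stable) = \<tau>" using h(2)[of Stable] by (simp add: \<beta>_def)
  have "h (relator i) = \<one>\<^bsub>?B\<^esub>" if i: "i \<in> {1..k}" for i
  proof -
    let ?x = "gen (Base i)"
    interpret h: group_hom FS ?B h using h(1) by unfold_locales
    note c = gen_Base[OF i] \<phi>_closed[OF gen_Base[OF i]]
    note cB = \<psi>_Bij[OF c(1)] \<psi>_Bij[OF c(2)] \<tau>_Bij
    have "\<tau> \<otimes>\<^bsub>?B\<^esub> \<psi> ?x = \<psi> (\<phi> ?x) \<otimes>\<^bsub>?B\<^esub> \<tau>"
    proof -
      have "f ((j + (m - 1)) mod m) (\<phi> ?x) = f j ?x" if "j < m" for j
      proof -
        have "Suc ((j + (m - 1)) mod m) mod m = j"
          using that m by (simp add: mod_Suc_eq)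
        then show ?thesis using shift[OF _ i, of "(j + (m - 1)) mod m"] m by simp
      qed
      then have "(\<lambda>z\<in>\<Omega>. \<tau> (\<psi> ?x z)) = (\<lambda>z\<in>\<Omega>. \<psi> (\<phi> ?x) (\<tau> z))"
        unfolding \<psi>_def \<tau>_def
        using m fc[OF c(1)] by (intro restrict_ext) (auto simp: \<Omega>_def)
      then show ?thesis
        unfolding mult[OF cB(3,1)] mult[OF cB(2,3)] .
    qed
    then have "\<tau> \<otimes>\<^bsub>?B\<^esub> \<psi> ?x \<otimes>\<^bsub>?B\<^esub> inv\<^bsub>?B\<^esub> \<tau> \<otimes>\<^bsub>?B\<^esub> inv\<^bsub>?B\<^esub> \<psi> (\<phi> ?x) = \<one>\<^bsub>?B\<^esub>"
      using cB[folded B_carrier] by (simp add: B.m_assoc)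
    then show ?thesis
      unfolding relator_def
      using gen_Stable FB_subset_FS[OF c(1)] FB_subset_FS[OF c(2)]
      by (simp only: h.hom_mult h.hom_inv FS.m_closed FS.inv_closed h_T h_FB[OF c(1)] h_FB[OF c(2)])
  qed
  from hom_factor[OF B.group_axioms h(1) this]
  obtain g where g: "g \<in> hom M ?B" "\<And>u. u \<in> carrier FS \<Longrightarrow> g (proj u) = h u" by blast
  show ?thesis
  proof (rule that[of g])
    show "g (proj v) = (\<lambda>(j, y)\<in>\<Omega>. (j, f j v \<otimes>\<^bsub>G\<^esub> y))" if "v \<in> carrier FB" for v
      using g(2)[OF FB_subset_FS[OF that]] h_FB[OF that] by (simp only: \<psi>_def)
    show "g T = (\<lambda>(j, y)\<in>\<Omega>. ((j + (m - 1)) mod m, y))"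
      using g(2)[OF gen_Stable] h_T by (simp only: \<tau>_def)
  qed (rule g(1))
qed

text \<open>If \<open>x\<close> acted trivially, both sides of \<open>eq\<close> would move the
  point \<open>(0, 1)\<close> alike: the layer gives \<open>a\<close> and \<open>b\<close> congruent
  modulo \<open>m\<close>, and the group component gives some trivial \<open>f j v\<close>.\<close>

lemma finite_index_avoiding:
  fixes f :: "nat \<Rightarrow> torus_gen word \<Rightarrow> 'g"
  assumes G: "group G" "finite (carrier G)" and m: "0 < m"
    and f: "\<And>j. f j \<in> hom FB G"
    and shift: "\<And>j i. j < m \<Longrightarrow> i \<in> {1..k} \<Longrightarrow> f j (\<phi> (gen (Base i))) = f (Suc j mod m) (gen (Base i))"
    and x: "x \<in> carrier M" and v: "v \<in> carrier FB"
    and eq: "T [^]\<^bsub>M\<^esub> a \<otimes>\<^bsub>M\<^esub> x = proj v \<otimes>\<^bsub>M\<^esub> T [^]\<^bsub>M\<^esub> b"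
    and ne: "a mod m \<noteq> b mod m \<or> (\<forall>j. f j v \<noteq> \<one>\<^bsub>G\<^esub>)"
  shows "\<exists>K. subgroup K M \<and> finite (rcosets\<^bsub>M\<^esub> K) \<and> x \<notin> K"
proof -
  interpret G: group G by fact
  define \<Omega> where "\<Omega> = {..<m} \<times> carrier G"
  let ?B = "BijGroup \<Omega>"
  interpret B: group ?B by (rule group_BijGroup)
  obtain g where "g \<in> hom M (BijGroup ({..<m} \<times> carrier G))"
    "\<And>v. v \<in> carrier FB \<Longrightarrow> g (proj v) = (\<lambda>(j, y)\<in>{..<m} \<times> carrier G. (j, f j v \<otimes>\<^bsub>G\<^esub> y))"
    "g T = (\<lambda>(j, y)\<in>{..<m} \<times> carrier G. ((j + (m - 1)) mod m, y))"
    by (rule hom_to_permutations[where f = f and m = m, OF G m f])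
       (use shift that in blast)+
  note g = this(1)[folded \<Omega>_def] this(2)[OF v, folded \<Omega>_def] this(3)[folded \<Omega>_def]
  interpret g: group_hom M ?B g using g(1) by unfold_locales
  have fin: "finite (carrier ?B)" using G(2) by (intro finite_BijGroup) (simp add: \<Omega>_def)
  have mult: "(p \<otimes>\<^bsub>?B\<^esub> q) z = p (q z)" if "p \<in> carrier ?B" "q \<in> carrier ?B" "z \<in> \<Omega>" for p q z
    using that by (simp add: BijGroup_def compose_def)
  have gT: "g T \<in> carrier ?B" by (rule g.hom_closed) simp
  have one: "\<one>\<^bsub>?B\<^esub> z = z" if "z \<in> \<Omega>" for z using that by (simp add: BijGroup_def)
  have pow: "(g T [^]\<^bsub>?B\<^esub> (c::nat)) (j, y) = ((j + c * (m - 1)) mod m, y)"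
    if "j < m" "y \<in> carrier G" for c j y
    using that
  proof (induction c arbitrary: j)
    case 0
    then show ?case using one[of "(j, y)"] by (simp add: \<Omega>_def)
  next
    case (Suc c)
    have jy: "(j, y) \<in> \<Omega>" using Suc.prems by (simp add: \<Omega>_def)
    have "(g T [^]\<^bsub>?B\<^esub> Suc c) (j, y) = (g T [^]\<^bsub>?B\<^esub> c) (g T (j, y))"
      using mult[OF B.nat_pow_closed[OF gT] gT jy] by simp
    also have "g T (j, y) = ((j + (m - 1)) mod m, y)" using jy by (simp add: g(3))
    also have "(g T [^]\<^bsub>?B\<^esub> c) ((j + (m - 1)) mod m, y) = (((j + (m - 1)) mod m + c * (m - 1)) mod m, y)"
      using m by (intro Suc.IH Suc.prems(2)) simp
    also have "((j + (m - 1)) mod m + c * (m - 1)) mod m = (j + Suc c * (m - 1)) mod m"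
      by (simp only: mod_add_left_eq mult_Suc add.assoc)
    finally show ?case .
  qed
  have "g x \<noteq> \<one>\<^bsub>?B\<^esub>"
  proof
    assume "g x = \<one>\<^bsub>?B\<^esub>"
    moreover have "g (T [^]\<^bsub>M\<^esub> a \<otimes>\<^bsub>M\<^esub> x) = g (proj v \<otimes>\<^bsub>M\<^esub> T [^]\<^bsub>M\<^esub> b)" by (simp only: eq)
    ultimately have *: "g T [^]\<^bsub>?B\<^esub> a = g (proj v) \<otimes>\<^bsub>?B\<^esub> g T [^]\<^bsub>?B\<^esub> b"
      using x proj_closed[OF v] by (simp add: g.hom_nat_pow)
    have z: "(0, \<one>\<^bsub>G\<^esub>) \<in> \<Omega>" using m by (simp add: \<Omega>_def)
    have zb: "(b * (m - 1) mod m, \<one>\<^bsub>G\<^esub>) \<in> \<Omega>" using m by (simp add: \<Omega>_def)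
    have fc: "f j v \<in> carrier G" for j using hom_in_carrier[OF f v] .
    have "(a * (m - 1) mod m, \<one>\<^bsub>G\<^esub>) = (g T [^]\<^bsub>?B\<^esub> a) (0, \<one>\<^bsub>G\<^esub>)" using pow[of 0] m by simp
    also have "\<dots> = g (proj v) ((g T [^]\<^bsub>?B\<^esub> b) (0, \<one>\<^bsub>G\<^esub>))"
      unfolding * using mult[OF g.hom_closed[OF proj_closed[OF v]] B.nat_pow_closed[OF gT] z] .
    also have "\<dots> = (b * (m - 1) mod m, f (b * (m - 1) mod m) v)"
      using pow[of 0] m zb fc by (simp add: g(2))
    finally have ab: "a * (m - 1) mod m = b * (m - 1) mod m" and fv: "f (b * (m - 1) mod m) v = \<one>\<^bsub>G\<^esub>"
      by auto
    \<comment> \<open>Multiplication by \<open>m - 1\<close> is negation modulo \<open>m\<close>;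
      adding \<open>a + b\<close> to both sides of \<open>ab\<close> removes it.\<close>
    have "(c * (m - 1) + c + d) mod m = d mod m" for c d
    proof -
      have "c * (m - 1) + c + d = c * m + d" using m by (cases m) simp_all
      then show ?thesis by simp
    qed
    from this[of a b] this[of b a] have "b mod m = a mod m"
      using mod_add_cong[OF ab refl, of "a + b"] by (simp add: add_ac)
    then show False using ne fv by auto
  qed
  then show ?thesis
    using finite_index_kernel[OF M.group_axioms B.group_axioms fin g(1) x] by blast
qed

end

theorem theorem1p2:
  fixes k :: nat
    and \<phi> :: "torus_gen word \<Rightarrow> torus_gen word"
  assumes "k \<ge> 1"
    and "\<phi> \<in> hom (free_group (base_gens k)) (free_group (base_gens k))"
    and "inj_on \<phi> (carrier (free_group (base_gens k)))"
  shows "residually_finite (mapping_torus k \<phi>)"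
proof -
  interpret torus k \<phi> by unfold_locales (rule assms(2))
  show ?thesis
  proof (rule residually_finiteI[OF M.group_axioms])
    fix x assume x: "x \<in> carrier M" "x \<noteq> \<one>\<^bsub>M\<^esub>"
    obtain u where u: "u \<in> carrier FS" "x = proj u" using proj_surj[OF x(1)] .
    obtain a b :: nat and v where v: "v \<in> carrier FB"
      and eq: "T [^]\<^bsub>M\<^esub> a \<otimes>\<^bsub>M\<^esub> x = proj v \<otimes>\<^bsub>M\<^esub> T [^]\<^bsub>M\<^esub> b"
      using normal_form[OF u(1)] u(2) by blast
    show "\<exists>K. subgroup K M \<and> finite (rcosets\<^bsub>M\<^esub> K) \<and> x \<notin> K"
    proof (cases "v = []")
      case True
      have "proj v = \<one>\<^bsub>M\<^esub>" using proj.hom_one by (simp add: True free_group_simps)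
      then have "T [^]\<^bsub>M\<^esub> a \<otimes>\<^bsub>M\<^esub> x = T [^]\<^bsub>M\<^esub> b" using eq by simp
      then have "a \<noteq> b" using x M.l_cancel_one[of "T [^]\<^bsub>M\<^esub> a" x] by auto
      \<comment> \<open>Here \<open>x\<close> is a power of \<open>T\<close> and is detected by the
        layers alone: \<open>G\<close> is trivial, and the modulus \<open>a + b + 1\<close> exceeds
        both exponents.\<close>
      define G where "G = singleton_group (0::nat)"
      have G: "group G" "finite (carrier G)" "(\<lambda>_. \<one>\<^bsub>G\<^esub>) \<in> hom FB G"
        unfolding G_def by (simp, simp, simp add: hom_def singleton_group_def)
      show ?thesis
        by (rule finite_index_avoiding[where f = "\<lambda>_ _. \<one>\<^bsub>G\<^esub>" and m = "a + b + 1", OF G(1,2) _ G(3) _ x(1) v eq])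
           (use \<open>a \<noteq> b\<close> in auto)
    next
      case False
      obtain G :: "mpoly2 mat2 set monoid" and f where G: "group G" "finite (carrier G)"
        and f: "\<And>j. f j \<in> hom FB G"
        and shift: "\<And>j i. i \<in> {1..k} \<Longrightarrow> f j (\<phi> (gen (Base i))) = f (Suc j) (gen (Base i))"
        and sep: "\<And>j. f j v \<noteq> \<one>\<^bsub>G\<^esub>"
        by (rule exists_finite_group_separating_iterates[OF assms(2,3) v False]) (rule that)
      \<comment> \<open>There are only finitely many choices for the values on the generators, so
        two of the \<open>f j\<close> coincide there.\<close>
      define r where "r j = restrict (\<lambda>i. f j (gen (Base i))) {1..k}" for j
      have "range r \<subseteq> {1..k} \<rightarrow>\<^sub>E carrier G"
        using hom_in_carrier[OF f gen_Base] by (auto simp: r_def)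
      then have "finite (range r)" by (rule finite_subset) (simp add: finite_PiE G(2))
      then have "\<not> inj r" using finite_imageD by blast
      then obtain p q where pq: "p < q" "r p = r q" by (metis injI linorder_neqE_nat)
      define m where "m = q - p"
      have m: "0 < m" using pq by (simp add: m_def)
      have per: "f (p + m) (gen (Base i)) = f p (gen (Base i))" if "i \<in> {1..k}" for i
        using fun_cong[OF pq(2), of i] that pq(1) by (simp add: r_def m_def)
      show ?thesis
      \<comment> \<open>Only the part from \<open>p\<close> to \<open>q\<close> is known to close up
        into a cycle, so the family is shifted by \<open>p\<close>.\<close>
      proof (rule finite_index_avoiding[where f = "\<lambda>j. f (p + j)" and m = m, OF G m f _ x(1) v eq])
        fix j i assume ji: "j < m" "i \<in> {1..k}"
        show "f (p + j) (\<phi> (gen (Base i))) = f (p + Suc j mod m) (gen (Base i))"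
        \<comment> \<open>At the last layer the index wraps to 0, and \<open>per\<close> identifies
          the two values.\<close>
        proof (cases "Suc j = m")
          case True
          then show ?thesis using shift[OF ji(2), of "p + j"] per[OF ji(2)] by auto
        next
          case False
          then show ?thesis using shift[OF ji(2), of "p + j"] ji(1) by simp
        qed
      qed (use sep in blast)
    qed
  qed
qed

end
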